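(* Let $\Lambda\subset\mathbb{R}^d$ be a bounded measurable set and let $\varphi$ be a zero mean complex Gaussian field on $\Lambda$ with $\mathbb{E}[\varphi(x)\varphi(y)]=0$ and $\mathbb{E}[\varphi(x)\varphi(y)^*]=C(x,y)$, admitting the Karhunen-Loève expansion $\varphi=\sum_{n\ge 1}s_n\sqrt{\mu_n}\,\phi_n$ described in the context. Let $T_C$ be the covariance operator on $L^2(\Lambda)$ with kernel $C$, and let $\kappa_1>0$ be its largest eigenvalue. Let $\hat\varphi=\varphi/\|\varphi\|_2$, and let $\hat\varphi_\bot$ be the component of $\hat\varphi$ orthogonal in $L^2(\Lambda)$ to the eigenspace of $T_C$ associated with $\kappa_1$. If $T_C$ is trace class, then for every $\varepsilon>0$, $$\lim_{r\to+\infty}\mathbb{P}\left(\|\hat\varphi_\bot\|_2>\varepsilon\;\middle|\;\|\varphi\|_2^2>r\right)=0.$$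
   Context: $\|\cdot\|_2$ is the norm of $L^2(\Lambda)$ (complex-valued functions, Lebesgue measure). The covariance operator is $(T_Cf)(x)=\int_\Lambda C(x,y)f(y)\,d^dy$ for $f\in L^2(\Lambda)$; it is a nonnegative self-adjoint operator, assumed nonzero. Its eigenvalues, counted with multiplicity, are $\mu_1\ge\mu_2\ge\cdots\ge 0$, with corresponding orthonormal eigenfunctions $\phi_n$; the distinct values taken by the $\mu_n$ are $\kappa_1>\kappa_2>\cdots$, so that $\kappa_1=\mu_1>0$. The variables $s_1,s_2,\dots$ are i.i.d. complex Gaussian (circularly symmetric) with $\mathbb{E}[s_n]=0$, $\mathbb{E}[s_ns_m]=0$, $\mathbb{E}[s_n^*s_m]=\delta_{nm}$. The field $\varphi$ is the sum of the series $\varphi=\sum_{n\ge1}s_n\sqrt{\mu_n}\,\phi_n$ (when $T_C$ is trace class, this series converges almost surely in $L^2(\Lambda)$). $\mathbb{P}$ is the law of the field. Letting $g_1$ be the (finite) multiplicity of $\kappa_1$, one has $\varphi_\bot=\sum_{n>g_1}s_n\sqrt{\mu_n}\,\phi_n$ and $\hat\varphi_\bot=\varphi_\bot/\|\varphi\|_2$. *)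

theory Defs
  imports "HOL-Probability.Probability"
begin

text \<open>
  Elements of the complex space \<open>L\<^sup>2(S)\<close> are represented by functions on the whole type; only
  their values on \<open>S\<close> matter, and equality of elements is equality almost everywhere on \<open>S\<close>.
\<close>

definition l2_space :: "'a::euclidean_space set \<Rightarrow> ('a \<Rightarrow> complex) set" where
  "l2_space S = {f \<in> borel_measurable (lebesgue_on S).
                   integrable (lebesgue_on S) (\<lambda>x. (cmod (f x))\<^sup>2)}"

definition l2_inner :: "'a::euclidean_space set \<Rightarrow> ('a \<Rightarrow> complex) \<Rightarrow> ('a \<Rightarrow> complex) \<Rightarrow> complex" where
  "l2_inner S f g = (LINT x|lebesgue_on S. cnj (f x) * g x)"

definition l2_norm :: "'a::euclidean_space set \<Rightarrow> ('a \<Rightarrow> complex) \<Rightarrow> real" where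
  "l2_norm S f = sqrt (LINT x|lebesgue_on S. (cmod (f x))\<^sup>2)"

text \<open>Orthonormal family indexed by \<open>J\<close> in the subspace \<open>V\<close>, with linear span dense in \<open>V\<close>.\<close>

definition l2_orthonormal_basis ::
    "'a::euclidean_space set \<Rightarrow> ('a \<Rightarrow> complex) set \<Rightarrow> 'i set \<Rightarrow> ('i \<Rightarrow> 'a \<Rightarrow> complex) \<Rightarrow> bool" where
  "l2_orthonormal_basis S V J e \<longleftrightarrow>
     (\<forall>n\<in>J. e n \<in> V) \<and>
     (\<forall>m\<in>J. \<forall>n\<in>J. l2_inner S (e m) (e n) = (if m = n then 1 else 0)) \<and>
     (\<forall>f\<in>V. \<forall>\<epsilon>>0. \<exists>F c. finite F \<and> F \<subseteq> J \<and> l2_norm S (\<lambda>x. f x - (\<Sum>n\<in>F. c n * e n x)) < \<epsilon>)"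

text \<open>
  The component of \<open>f\<close> orthogonal to the subspace \<open>V\<close>: the element \<open>g\<close> orthogonal to \<open>V\<close> with
  \<open>f - g\<close> in \<open>V\<close>. For a closed \<open>V\<close> it exists and is unique up to equality almost everywhere on \<open>S\<close>.
\<close>

definition l2_orthogonal_component ::
    "'a::euclidean_space set \<Rightarrow> ('a \<Rightarrow> complex) set \<Rightarrow> ('a \<Rightarrow> complex) \<Rightarrow> 'a \<Rightarrow> complex" where
  "l2_orthogonal_component S V f =
     (SOME g. g \<in> l2_space S \<and> (\<forall>h\<in>V. l2_inner S h g = 0) \<and> (\<lambda>x. f x - g x) \<in> V)"

definition kernel_operator ::
    "'a::euclidean_space set \<Rightarrow> ('a \<Rightarrow> 'a \<Rightarrow> complex) \<Rightarrow> ('a \<Rightarrow> complex) \<Rightarrow> 'a \<Rightarrow> complex" where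
  "kernel_operator S C f = (\<lambda>x. LINT y|lebesgue_on S. C x y * f y)"

text \<open>
  The kernel defines an operator on all of \<open>L\<^sup>2(S)\<close>; the integrability clause is needed because
  the Bochner integral of a non-integrable function is \<open>0\<close> by convention.
\<close>

definition kernel_operator_on_l2 :: "'a::euclidean_space set \<Rightarrow> ('a \<Rightarrow> 'a \<Rightarrow> complex) \<Rightarrow> bool" where
  "kernel_operator_on_l2 S C \<longleftrightarrow>
     (\<forall>f\<in>l2_space S.
        (AE x in lebesgue_on S. integrable (lebesgue_on S) (\<lambda>y. C x y * f y)) \<and>
        kernel_operator S C f \<in> l2_space S)"

text \<open>
  For an everywhere defined operator, symmetry is self-adjointness, and it entails boundedness
  (Hellinger--Toeplitz) and linearity.
\<close>

definition l2_nonneg_self_adjoint ::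
    "'a::euclidean_space set \<Rightarrow> (('a \<Rightarrow> complex) \<Rightarrow> 'a \<Rightarrow> complex) \<Rightarrow> bool" where
  "l2_nonneg_self_adjoint S T \<longleftrightarrow>
     (\<forall>f\<in>l2_space S. T f \<in> l2_space S) \<and>
     (\<forall>f\<in>l2_space S. \<forall>g\<in>l2_space S. l2_inner S f (T g) = l2_inner S (T f) g) \<and>
     (\<forall>f\<in>l2_space S. 0 \<le> Re (l2_inner S f (T f)))"

text \<open>
  A nonnegative operator coincides with its absolute value, so it is trace class iff its diagonal
  is summable in an orthonormal basis; the sum does not depend on the basis. If \<open>S\<close> is not a
  null set, \<open>L\<^sup>2(S)\<close> is separable and infinite-dimensional, so its bases are indexed by \<open>nat\<close>.
\<close>

definition l2_nonneg_trace_class ::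
    "'a::euclidean_space set \<Rightarrow> (('a \<Rightarrow> complex) \<Rightarrow> 'a \<Rightarrow> complex) \<Rightarrow> bool" where
  "l2_nonneg_trace_class S T \<longleftrightarrow>
     l2_nonneg_self_adjoint S T \<and>
     (\<exists>e :: nat \<Rightarrow> 'a \<Rightarrow> complex. l2_orthonormal_basis S (l2_space S) UNIV e \<and>
        summable (\<lambda>n. Re (l2_inner S (e n) (T (e n)))))"

definition l2_eigenspace ::
    "'a::euclidean_space set \<Rightarrow> (('a \<Rightarrow> complex) \<Rightarrow> 'a \<Rightarrow> complex) \<Rightarrow> real \<Rightarrow> ('a \<Rightarrow> complex) set" where
  "l2_eigenspace S T \<kappa> =
     {f \<in> l2_space S. AE x in lebesgue_on S. T f x = complex_of_real \<kappa> * f x}"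

definition l2_eigenvalues ::
    "'a::euclidean_space set \<Rightarrow> (('a \<Rightarrow> complex) \<Rightarrow> 'a \<Rightarrow> complex) \<Rightarrow> real set" where
  "l2_eigenvalues S T = {\<kappa>. \<exists>f\<in>l2_eigenspace S T \<kappa>. \<not> (AE x in lebesgue_on S. f x = 0)}"

text \<open>
  \<open>\<mu> 0 \<ge> \<mu> 1 \<ge> \<dots> \<ge> 0\<close> lists the eigenvalues of \<open>T\<close> with multiplicity, and \<open>\<phi> n\<close> are
  corresponding orthonormal eigenfunctions: every eigenspace of a positive eigenvalue \<open>\<kappa>\<close> has
  the \<open>\<phi> n\<close> with \<open>\<mu> n = \<kappa>\<close> as an orthonormal basis. The eigenvalue \<open>0\<close> need not be
  listed exhaustively: a nonincreasing sequence with infinitely many positive terms cannot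
  contain it, while for \<open>T\<close> of finite rank the sequence is continued by zeros.
\<close>

definition l2_eigen_system ::
    "'a::euclidean_space set \<Rightarrow> (('a \<Rightarrow> complex) \<Rightarrow> 'a \<Rightarrow> complex) \<Rightarrow>
     (nat \<Rightarrow> real) \<Rightarrow> (nat \<Rightarrow> 'a \<Rightarrow> complex) \<Rightarrow> bool" where
  "l2_eigen_system S T \<mu> \<phi> \<longleftrightarrow>
     antimono \<mu> \<and> (\<forall>n. 0 \<le> \<mu> n) \<and>
     (\<forall>n. \<phi> n \<in> l2_eigenspace S T (\<mu> n)) \<and>
     (\<forall>m n. l2_inner S (\<phi> m) (\<phi> n) = (if m = n then 1 else 0)) \<and>
     (\<forall>\<kappa>>0. l2_orthonormal_basis S (l2_eigenspace S T \<kappa>) {n. \<mu> n = \<kappa>} \<phi>)"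

text \<open>Real Gaussian random variable, with constants allowed as the degenerate case.\<close>

definition real_gaussian :: "'w measure \<Rightarrow> ('w \<Rightarrow> real) \<Rightarrow> bool" where
  "real_gaussian M Y \<longleftrightarrow>
     Y \<in> borel_measurable M \<and>
     ((\<exists>m. AE \<omega> in M. Y \<omega> = m) \<or>
      (\<exists>m \<sigma>. \<sigma> > 0 \<and> distributed M lborel Y (normal_density m \<sigma>)))"

text \<open>
  Jointly Gaussian complex family. As \<open>Re (c * z)\<close> ranges over all real linear functionals of
  \<open>z\<close>, this says that the real and imaginary parts of the \<open>Z i\<close> are jointly Gaussian.
\<close>

definition complex_gaussian_field :: "'w measure \<Rightarrow> 'i set \<Rightarrow> ('i \<Rightarrow> 'w \<Rightarrow> complex) \<Rightarrow> bool" where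
  "complex_gaussian_field M I Z \<longleftrightarrow>
     (\<forall>F c. finite F \<and> F \<subseteq> I \<longrightarrow> real_gaussian M (\<lambda>\<omega>. Re (\<Sum>i\<in>F. c i * Z i \<omega>)))"

text \<open>
  Circularly symmetric complex Gaussian variable: real and imaginary parts are independent
  centred normal variables of the same variance.
\<close>

definition circular_complex_gaussian :: "'w measure \<Rightarrow> ('w \<Rightarrow> complex) \<Rightarrow> bool" where
  "circular_complex_gaussian M Z \<longleftrightarrow>
     prob_space.indep_var M borel (\<lambda>\<omega>. Re (Z \<omega>)) borel (\<lambda>\<omega>. Im (Z \<omega>)) \<and>
     (\<exists>\<sigma>>0. distributed M lborel (\<lambda>\<omega>. Re (Z \<omega>)) (normal_density 0 \<sigma>) \<and>
            distributed M lborel (\<lambda>\<omega>. Im (Z \<omega>)) (normal_density 0 \<sigma>))"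

end

theory Submission
  imports Defs "HOL-Real_Asymp.Real_Asymp"
begin

text \<open>
  Almost surely \<open>\<parallel>\<Phi>\<parallel>\<^sup>2 = \<Sum> \<mu>\<^sub>n X\<^sub>n\<close> with independent exponential variables \<open>X\<^sub>n = \<bar>s\<^sub>n\<bar>\<^sup>2\<close>, and
  \<open>\<parallel>\<Phi>\<^sub>\<bottom>\<parallel>\<^sup>2\<close> is the part of this sum over \<open>\<mu>\<^sub>n \<noteq> \<kappa>\<^sub>1\<close>. A single leading term already gives
  \<open>P(\<parallel>\<Phi>\<parallel>\<^sup>2 > r) \<ge> exp(-r/\<kappa>\<^sub>1 - O(\<surd>r))\<close>. On the event
  \<open>\<parallel>\<Phi>\<^sub>\<bottom>\<parallel>\<^sup>2 > \<epsilon>\<^sup>2 \<parallel>\<Phi>\<parallel>\<^sup>2\<close>, \<open>\<parallel>\<Phi>\<parallel>\<^sup>2 > r\<close>, one has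
  \<open>l \<parallel>\<Phi>\<parallel>\<^sup>2 + t (\<parallel>\<Phi>\<^sub>\<bottom>\<parallel>\<^sup>2 - \<epsilon>\<^sup>2 \<parallel>\<Phi>\<parallel>\<^sup>2) \<ge> l r\<close>. For \<open>l = 1/\<kappa>\<^sub>1 + t \<epsilon>\<^sup>2/2\<close> and small \<open>t > 0\<close>, the
  spectral gap below \<open>\<kappa>\<^sub>1\<close> keeps the exponential moment of the left-hand side finite. So the event
  has probability \<open>O(exp(-l r))\<close>, which is negligible because \<open>l > 1/\<kappa>\<^sub>1\<close>.
\<close>

subsection \<open>The seminormed space of square integrable functions\<close>

lemma integrable_if_norm_le:
  fixes f :: "'a \<Rightarrow> 'b::{banach, second_countable_topology}"
  assumes bound: "\<And>x. norm (f x) \<le> g x" and "f \<in> borel_measurable M" and "integrable M g"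
  shows "integrable M f"
proof (rule Bochner_Integration.integrable_bound[OF assms(3,2)])
  show "AE x in M. norm (f x) \<le> norm (g x)"
    using bound by (intro AE_I2 order_trans[OF bound]) simp
qed

lemma l2_spaceI:
  "f \<in> borel_measurable (lebesgue_on S) \<Longrightarrow> integrable (lebesgue_on S) (\<lambda>x. (cmod (f x))\<^sup>2) \<Longrightarrow>
    f \<in> l2_space S"
  by (simp add: l2_space_def)

lemma l2_space_measurable: "f \<in> l2_space S \<Longrightarrow> f \<in> borel_measurable (lebesgue_on S)"
  and l2_space_integrable: "f \<in> l2_space S \<Longrightarrow> integrable (lebesgue_on S) (\<lambda>x. (cmod (f x))\<^sup>2)"
  by (simp_all add: l2_space_def)

lemma l2_space_scale:
  assumes "f \<in> l2_space S"
  shows "(\<lambda>x. c * f x) \<in> l2_space S"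
proof (rule l2_spaceI)
  note [measurable] = l2_space_measurable[OF assms]
  show "(\<lambda>x. c * f x) \<in> borel_measurable (lebesgue_on S)"
    by measurable
  show "integrable (lebesgue_on S) (\<lambda>x. (cmod (c * f x))\<^sup>2)"
    using l2_space_integrable[OF assms] by (simp add: norm_mult power_mult_distrib)
qed

lemma l2_space_add:
  assumes "f \<in> l2_space S" "g \<in> l2_space S"
  shows "(\<lambda>x. f x + g x) \<in> l2_space S"
proof (rule l2_spaceI)
  note [measurable] = assms[THEN l2_space_measurable]
  show m: "(\<lambda>x. f x + g x) \<in> borel_measurable (lebesgue_on S)"
    by measurable
  have "norm ((cmod (f x + g x))\<^sup>2) \<le> 2 * (cmod (f x))\<^sup>2 + 2 * (cmod (g x))\<^sup>2" for x
  proof -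
    have "(cmod (f x + g x))\<^sup>2 \<le> (cmod (f x) + cmod (g x))\<^sup>2"
      by (intro power_mono norm_triangle_ineq) simp
    then show ?thesis
      using sum_squares_bound[of "cmod (f x)" "cmod (g x)"] by (simp add: power2_sum)
  qed
  moreover have "(\<lambda>x. (cmod (f x + g x))\<^sup>2) \<in> borel_measurable (lebesgue_on S)"
    using m by measurable
  moreover have "integrable (lebesgue_on S) (\<lambda>x. 2 * (cmod (f x))\<^sup>2 + 2 * (cmod (g x))\<^sup>2)"
    using assms[THEN l2_space_integrable] by simp
  ultimately show "integrable (lebesgue_on S) (\<lambda>x. (cmod (f x + g x))\<^sup>2)"
    by (rule integrable_if_norm_le)
qed

lemma l2_space_diff:
  assumes "f \<in> l2_space S" "g \<in> l2_space S"
  shows "(\<lambda>x. f x - g x) \<in> l2_space S"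
  using l2_space_add[OF assms(1) l2_space_scale[OF assms(2), of "-1"]] by simp

lemma l2_space_zero: "(\<lambda>x. 0) \<in> l2_space S"
  by (rule l2_spaceI) auto

lemma l2_space_combination:
  assumes "\<And>n. n \<in> F \<Longrightarrow> f n \<in> l2_space S"
  shows "(\<lambda>x. \<Sum>n\<in>F. c n * f n x) \<in> l2_space S"
  using assms
  by (induction F rule: infinite_finite_induct)
     (simp_all add: l2_space_zero l2_space_add l2_space_scale)

lemma l2_inner_integrable:
  assumes "f \<in> l2_space S" "g \<in> l2_space S"
  shows "integrable (lebesgue_on S) (\<lambda>x. cnj (f x) * g x)"
proof -
  have "norm (cnj (f x) * g x) \<le> (cmod (f x))\<^sup>2 + (cmod (g x))\<^sup>2" for x
  proof -
    have "0 \<le> cmod (f x) * cmod (g x)" by simp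
    then show ?thesis
      using sum_squares_bound[of "cmod (f x)" "cmod (g x)"] unfolding norm_mult complex_mod_cnj
      by linarith
  qed
  moreover have "(\<lambda>x. cnj (f x) * g x) \<in> borel_measurable (lebesgue_on S)"
    using measurable_compose[OF l2_space_measurable[OF assms(1)]
        borel_measurable_continuous_onI[OF continuous_on_cnj[OF continuous_on_id]]]
    by (rule borel_measurable_times) (rule l2_space_measurable[OF assms(2)])
  moreover have "integrable (lebesgue_on S) (\<lambda>x. (cmod (f x))\<^sup>2 + (cmod (g x))\<^sup>2)"
    using assms[THEN l2_space_integrable] by simp
  ultimately show ?thesis
    by (rule integrable_if_norm_le)
qed

lemma l2_inner_scale_right: "l2_inner S f (\<lambda>x. c * g x) = c * l2_inner S f g"
  unfolding l2_inner_def by (simp add: mult.left_commute)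

lemma l2_inner_scale_left: "l2_inner S (\<lambda>x. c * f x) g = cnj c * l2_inner S f g"
  unfolding l2_inner_def by (simp add: mult.assoc)

lemma l2_inner_add_right:
  assumes "f \<in> l2_space S" "g \<in> l2_space S" "h \<in> l2_space S"
  shows "l2_inner S f (\<lambda>x. g x + h x) = l2_inner S f g + l2_inner S f h"
  unfolding l2_inner_def
  using Bochner_Integration.integral_add[OF l2_inner_integrable[OF assms(1,2)] l2_inner_integrable[OF assms(1,3)]]
  by (simp add: distrib_left)

lemma l2_inner_diff_right:
  assumes "f \<in> l2_space S" "g \<in> l2_space S" "h \<in> l2_space S"
  shows "l2_inner S f (\<lambda>x. g x - h x) = l2_inner S f g - l2_inner S f h"
  unfolding l2_inner_def
  using Bochner_Integration.integral_diff[OF l2_inner_integrable[OF assms(1,2)] l2_inner_integrable[OF assms(1,3)]]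
  by (simp add: right_diff_distrib)

lemma l2_inner_commute: "l2_inner S g f = cnj (l2_inner S f g)"
  unfolding l2_inner_def Bochner_Integration.integral_cnj[symmetric] by (simp add: mult.commute)

lemma l2_inner_combination_right:
  assumes "g \<in> l2_space S" "\<And>n. n \<in> F \<Longrightarrow> f n \<in> l2_space S"
  shows "l2_inner S g (\<lambda>x. \<Sum>n\<in>F. c n * f n x) = (\<Sum>n\<in>F. c n * l2_inner S g (f n))"
  using assms(2)
proof (induction F rule: infinite_finite_induct)
  case (insert a F)
  then show ?case
    by (simp add: l2_inner_add_right[OF assms(1)] l2_space_scale l2_space_combination
        l2_inner_scale_right)
qed (simp_all add: l2_inner_def)

lemma l2_norm_nonneg: "0 \<le> l2_norm S f"
  by (simp add: l2_norm_def)

lemma l2_norm_sq: "(l2_norm S f)\<^sup>2 = (LINT x|lebesgue_on S. (cmod (f x))\<^sup>2)"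
  by (simp add: l2_norm_def)

lemma l2_inner_self: "l2_inner S f f = complex_of_real ((l2_norm S f)\<^sup>2)"
proof -
  have "(\<lambda>x. cnj (f x) * f x) = (\<lambda>x. complex_of_real ((cmod (f x))\<^sup>2))"
    unfolding complex_norm_square by (simp add: mult.commute)
  then show ?thesis
    unfolding l2_inner_def l2_norm_sq by (simp only: integral_complex_of_real)
qed

lemma l2_norm_scale: "l2_norm S (\<lambda>x. c * f x) = cmod c * l2_norm S f"
  unfolding l2_norm_def by (simp add: norm_mult power_mult_distrib real_sqrt_mult)

lemma l2_norm_minus_commute: "l2_norm S (\<lambda>x. f x - g x) = l2_norm S (\<lambda>x. g x - f x)"
  unfolding l2_norm_def by (simp add: norm_minus_commute)

lemma l2_norm_sq_add:
  assumes "f \<in> l2_space S" "g \<in> l2_space S"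
  shows "(l2_norm S (\<lambda>x. f x + g x))\<^sup>2 = (l2_norm S f)\<^sup>2 + (l2_norm S g)\<^sup>2 + 2 * Re (l2_inner S f g)"
proof -
  have pointwise: "(cmod (f x + g x))\<^sup>2 = (cmod (f x))\<^sup>2 + (cmod (g x))\<^sup>2 + 2 * Re (cnj (f x) * g x)" for x
    by (simp only: cmod_power2) (simp add: power2_eq_square algebra_simps)
  show ?thesis
    unfolding l2_norm_sq pointwise l2_inner_def integral_Re[OF l2_inner_integrable[OF assms], symmetric]
    using assms[THEN l2_space_integrable] integrable_Re[OF l2_inner_integrable[OF assms]]
    by (simp del: times_complex.sel)
qed

text \<open>The squared seminorm of \<open>f\<close> plus a multiple of \<open>g\<close> is
  nonnegative; read as a quadratic in a real parameter, this gives the inequality. Nonzero functions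
  can have seminorm zero, so that case for \<open>g\<close> is split off.\<close>

lemma l2_Cauchy_Schwarz:
  assumes "f \<in> l2_space S" "g \<in> l2_space S"
  shows "cmod (l2_inner S f g) \<le> l2_norm S f * l2_norm S g"
proof -
  define c where "c = l2_inner S f g"
  \<comment> \<open>The factor \<open>cnj c\<close> turns the phase of \<open>g\<close> so that the
    cross term becomes the real number \<open>t * (cmod c)\<^sup>2\<close>.\<close>
  have quadratic: "0 \<le> (l2_norm S f)\<^sup>2 + (t * cmod c * l2_norm S g)\<^sup>2 + 2 * t * (cmod c)\<^sup>2" for t :: real
  proof -
    have "complex_of_real t * cnj c * l2_inner S f g = complex_of_real (t * (cmod c)\<^sup>2)"
      using complex_norm_square[of c] by (simp add: c_def mult.commute)
    then have "Re (l2_inner S f (\<lambda>x. complex_of_real t * cnj c * g x)) = t * (cmod c)\<^sup>2"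
      by (simp only: l2_inner_scale_right Re_complex_of_real)
    then have "(l2_norm S (\<lambda>x. f x + complex_of_real t * cnj c * g x))\<^sup>2
        = (l2_norm S f)\<^sup>2 + (t * cmod c * l2_norm S g)\<^sup>2 + 2 * (t * (cmod c)\<^sup>2)"
      using l2_norm_sq_add[OF assms(1) l2_space_scale[OF assms(2)], of "complex_of_real t * cnj c"]
      by (simp add: l2_norm_scale norm_mult power_mult_distrib)
    then show ?thesis
      by (metis zero_le_power2 mult.assoc)
  qed
  have "(cmod c)\<^sup>2 \<le> (l2_norm S f * l2_norm S g)\<^sup>2"
  proof (cases "c = 0")
    case False
    then have c: "(cmod c)\<^sup>2 > 0" by simp
    show ?thesis
    proof (cases "l2_norm S g = 0")
      case True
      then show ?thesis
        \<comment> \<open>With no square term in \<open>t\<close> left, the expression is affine,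
          and at this \<open>t\<close> it equals -1.\<close>
        using quadratic[of "- ((l2_norm S f)\<^sup>2 + 1) / (2 * (cmod c)\<^sup>2)"] c
        by (simp add: field_simps)
    next
      case False
      then have g: "(l2_norm S g)\<^sup>2 > 0" by simp
      \<comment> \<open>The point \<open>- 1 / (l2_norm S g)\<^sup>2\<close> is the minimiser of the
        quadratic.\<close>
      have "(- 1 / (l2_norm S g)\<^sup>2 * cmod c * l2_norm S g)\<^sup>2 = (cmod c)\<^sup>2 / (l2_norm S g)\<^sup>2"
        using False by (simp add: power2_eq_square)
      then have "0 \<le> (l2_norm S f)\<^sup>2 - (cmod c)\<^sup>2 / (l2_norm S g)\<^sup>2"
        using quadratic[of "- 1 / (l2_norm S g)\<^sup>2"] by simp
      then show ?thesis
        using g by (simp add: power_mult_distrib field_simps)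
    qed
  qed simp
  then show ?thesis
    unfolding c_def by (rule power2_le_imp_le) (simp add: l2_norm_nonneg)
qed

lemma l2_norm_triangle:
  assumes "f \<in> l2_space S" "g \<in> l2_space S"
  shows "l2_norm S (\<lambda>x. f x + g x) \<le> l2_norm S f + l2_norm S g"
proof (rule power2_le_imp_le)
  show "(l2_norm S (\<lambda>x. f x + g x))\<^sup>2 \<le> (l2_norm S f + l2_norm S g)\<^sup>2"
    using l2_norm_sq_add[OF assms] l2_Cauchy_Schwarz[OF assms] complex_Re_le_cmod[of "l2_inner S f g"]
    by (simp add: power2_sum)
qed (simp add: l2_norm_nonneg)

lemma l2_norm_eq_0_iff:
  assumes "f \<in> l2_space S"
  shows "l2_norm S f = 0 \<longleftrightarrow> (AE x in lebesgue_on S. f x = 0)"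
  using integral_nonneg_eq_0_iff_AE[OF l2_space_integrable[OF assms]]
  by (simp add: l2_norm_def)

lemma l2_norm_sq_orthonormal_combination:
  assumes "\<And>n. \<phi> n \<in> l2_space S"
    and "\<And>m n. l2_inner S (\<phi> m) (\<phi> n) = (if m = n then 1 else 0)"
    and "finite F"
  shows "(l2_norm S (\<lambda>x. \<Sum>n\<in>F. c n * \<phi> n x))\<^sup>2 = (\<Sum>n\<in>F. (cmod (c n))\<^sup>2)"
  using assms(3)
proof (induction F)
  case (insert a F)
  have "(l2_norm S (\<phi> a))\<^sup>2 = 1"
    using l2_inner_self[of S "\<phi> a"] assms(2)[of a a] by (metis of_real_eq_1_iff)
  moreover have "l2_inner S (\<phi> a) (\<lambda>x. \<Sum>n\<in>F. c n * \<phi> n x) = 0"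
    using insert(2) by (auto simp: l2_inner_combination_right assms(1,2) intro!: sum.neutral)
  ultimately show ?case
    using insert l2_norm_sq_add[OF l2_space_scale[OF assms(1)[of a], of "c a"] l2_space_combination[of F \<phi> S c]]
    by (simp add: l2_norm_scale l2_inner_scale_left assms(1) power_mult_distrib)
qed (simp add: l2_norm_def)

subsection \<open>Expansions in orthonormal systems\<close>

text \<open>Once \<open>N\<close> exceeds every index in \<open>J\<close>, dropping the
  \<open>J\<close> terms from both \<open>f\<close> and its partial sum leaves their difference
  unchanged. So the partial sums off \<open>J\<close> converge to the residual, and Pythagoras gives
  their squared norms. The empty \<open>J\<close> yields the whole squared norm, the leading indices
  yield the orthogonal part.\<close>

lemma l2_expansion_residual_sums:
  assumes "\<And>n. \<phi> n \<in> l2_space S"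
    and "\<And>m n. l2_inner S (\<phi> m) (\<phi> n) = (if m = n then 1 else 0)"
    and "f \<in> l2_space S"
    and lim: "(\<lambda>N. l2_norm S (\<lambda>x. f x - (\<Sum>n<N. a n * \<phi> n x))) \<longlonglongrightarrow> 0"
    and "finite J"
  shows "(\<lambda>n. if n \<in> J then 0 else (cmod (a n))\<^sup>2) sums (l2_norm S (\<lambda>x. f x - (\<Sum>n\<in>J. a n * \<phi> n x)))\<^sup>2"
proof -
  define g where "g = (\<lambda>x. f x - (\<Sum>n\<in>J. a n * \<phi> n x))"
  define R where "R N = (\<lambda>x. \<Sum>n\<in>{..<N} - J. a n * \<phi> n x)" for N
  have g: "g \<in> l2_space S"
    unfolding g_def by (intro l2_space_diff l2_space_combination assms)
  have R: "R N \<in> l2_space S" for N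
    unfolding R_def by (intro l2_space_combination assms)
  obtain N0 where N0: "\<And>n. n \<in> J \<Longrightarrow> n < N0"
    using assms(5) unfolding finite_nat_set_iff_bounded by blast
  have residual: "(\<lambda>x. g x - R N x) = (\<lambda>x. f x - (\<Sum>n<N. a n * \<phi> n x))" if "N \<ge> N0" for N
  proof -
    have "J \<subseteq> {..<N}"
      using N0 that by force
    then have "(\<Sum>n<N. a n * \<phi> n x) = (\<Sum>n\<in>{..<N} - J. a n * \<phi> n x) + (\<Sum>n\<in>J. a n * \<phi> n x)" for x
      by (rule sum.subset_diff) simp
    then show ?thesis
      unfolding g_def R_def by (simp only: diff_diff_add add.commute)
  qed
  \<comment> \<open>Reverse triangle inequality, from the two ordinary ones.\<close>
  have diff: "\<bar>l2_norm S g - l2_norm S (R N)\<bar> \<le> l2_norm S (\<lambda>x. g x - R N x)" for N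
    using l2_norm_triangle[OF l2_space_diff[OF g R[of N]] R[of N]]
      l2_norm_triangle[OF l2_space_diff[OF R[of N] g] g]
    unfolding l2_norm_minus_commute[of S "R N" g] diff_add_cancel by linarith
  have "norm (l2_norm S (R N) - l2_norm S g) \<le> l2_norm S (\<lambda>x. f x - (\<Sum>n<N. a n * \<phi> n x))"
    if "N \<ge> N0" for N
    using diff[of N] unfolding residual[OF that] by (simp add: abs_minus_commute)
  then have "eventually (\<lambda>N. norm (l2_norm S (R N) - l2_norm S g)
      \<le> l2_norm S (\<lambda>x. f x - (\<Sum>n<N. a n * \<phi> n x))) sequentially"
    by (rule eventually_sequentiallyI)
  from Lim_null_comparison[OF this lim] have "(\<lambda>N. l2_norm S (R N)) \<longlonglongrightarrow> l2_norm S g"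
    by (rule LIM_zero_cancel)
  then have "(\<lambda>N. (l2_norm S (R N))\<^sup>2) \<longlonglongrightarrow> (l2_norm S g)\<^sup>2"
    by (intro tendsto_power)
  moreover have "(l2_norm S (R N))\<^sup>2 = (\<Sum>n<N. if n \<in> J then 0 else (cmod (a n))\<^sup>2)" for N
    unfolding R_def l2_norm_sq_orthonormal_combination[OF assms(1,2) finite_Diff[OF finite_lessThan]]
    by (rule sum.mono_neutral_cong_left) auto
  ultimately show ?thesis
    unfolding sums_def g_def by simp
qed

text \<open>Pairing with \<open>\<phi> m\<close> is continuous by Cauchy-Schwarz, and on the
  residuals with \<open>N > m\<close> it takes the constant value
  \<open>l2_inner S (\<phi> m) f - a m\<close>. As the residuals tend to zero, this constant is
  zero.\<close>

lemma l2_expansion_coefficient: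
  assumes "\<And>n. \<phi> n \<in> l2_space S"
    and "\<And>m n. l2_inner S (\<phi> m) (\<phi> n) = (if m = n then 1 else 0)"
    and "f \<in> l2_space S"
    and lim: "(\<lambda>N. l2_norm S (\<lambda>x. f x - (\<Sum>n<N. a n * \<phi> n x))) \<longlonglongrightarrow> 0"
  shows "l2_inner S (\<phi> m) f = a m"
proof -
  define h where "h N = (\<lambda>x. f x - (\<Sum>n<N. a n * \<phi> n x))" for N
  have h: "h N \<in> l2_space S" for N
    unfolding h_def by (intro l2_space_diff l2_space_combination assms)
  have "(l2_norm S (\<phi> m))\<^sup>2 = 1"
    using l2_inner_self[of S "\<phi> m"] assms(2)[of m m] by (metis of_real_eq_1_iff)
  then have "l2_norm S (\<phi> m) = 1"
    using l2_norm_nonneg[of S "\<phi> m"] by (auto simp: power2_eq_1_iff)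
  then have bound: "cmod (l2_inner S (\<phi> m) (h N)) \<le> l2_norm S (h N)" for N
    using l2_Cauchy_Schwarz[OF assms(1) h, of m N] by simp
  have "l2_inner S (\<phi> m) (h N) = l2_inner S (\<phi> m) f - a m" if "N > m" for N
  proof -
    have "(\<Sum>n<N. a n * l2_inner S (\<phi> m) (\<phi> n)) = a m"
      using that by (simp add: assms(2) if_distrib[of "(*) _"] cong: if_cong)
    then show ?thesis
      unfolding h_def
      by (simp add: l2_inner_diff_right l2_space_combination l2_inner_combination_right assms(1,3))
  qed
  then have "cmod (l2_inner S (\<phi> m) f - a m) \<le> l2_norm S (h N)" if "N \<ge> Suc m" for N
    using bound[of N] that by simp
  then have "eventually (\<lambda>N. cmod (l2_inner S (\<phi> m) f - a m) \<le> l2_norm S (h N)) sequentially"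
    by (rule eventually_sequentiallyI)
  moreover have "(\<lambda>N. l2_norm S (h N)) \<longlonglongrightarrow> 0"
    using lim by (simp add: h_def)
  ultimately have "cmod (l2_inner S (\<phi> m) f - a m) \<le> 0"
    by (intro tendsto_lowerbound[where F = sequentially]) auto
  then show ?thesis by simp
qed

text \<open>Finite combinations of the basis are orthogonal to \<open>g\<close> and come arbitrarily
  close to \<open>h\<close>; Cauchy-Schwarz controls the remaining error.\<close>

lemma l2_orthogonal_if_orthogonal_to_basis:
  assumes V: "V \<subseteq> l2_space S" and basis: "l2_orthonormal_basis S V J e"
    and g: "g \<in> l2_space S" and orth: "\<And>n. n \<in> J \<Longrightarrow> l2_inner S (e n) g = 0"
    and h: "h \<in> V"
  shows "l2_inner S h g = 0"
proof -
  have small: "cmod (l2_inner S h g) \<le> \<delta> * l2_norm S g" if "\<delta> > 0" for \<delta>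
  proof -
    from basis h that obtain F c where F: "finite F" "F \<subseteq> J"
      and approx: "l2_norm S (\<lambda>x. h x - (\<Sum>n\<in>F. c n * e n x)) < \<delta>"
      unfolding l2_orthonormal_basis_def by blast
    define k where "k = (\<lambda>x. \<Sum>n\<in>F. c n * e n x)"
    have e: "e n \<in> l2_space S" if "n \<in> F" for n
      using basis V F that unfolding l2_orthonormal_basis_def by blast
    have k: "k \<in> l2_space S" and hS: "h \<in> l2_space S"
      using e h V unfolding k_def by (blast intro: l2_space_combination)+
    have "l2_inner S g (e n) = 0" if "n \<in> F" for n
      using orth[of n] F that l2_inner_commute[of S g "e n"] by auto
    then have "l2_inner S g k = 0"
      using e unfolding k_def by (subst l2_inner_combination_right) (auto simp: g)
    then have "l2_inner S g h = l2_inner S g (\<lambda>x. h x - k x)"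
      by (simp add: l2_inner_diff_right g hS k)
    then have "cmod (l2_inner S h g) \<le> l2_norm S g * l2_norm S (\<lambda>x. h x - k x)"
      using l2_Cauchy_Schwarz[OF g l2_space_diff[OF hS k]] l2_inner_commute[of S h g] by simp
    also have "\<dots> \<le> l2_norm S g * \<delta>"
      using approx by (intro mult_left_mono) (auto simp: k_def l2_norm_nonneg)
    finally show ?thesis by (simp add: mult.commute)
  qed
  have "((\<lambda>\<delta>. \<delta> * l2_norm S g) \<longlongrightarrow> 0 * l2_norm S g) (at_right 0)"
    by (intro tendsto_intros)
  moreover have "eventually (\<lambda>\<delta>. cmod (l2_inner S h g) \<le> \<delta> * l2_norm S g) (at_right 0)"
    using small by (auto simp: eventually_at_filter)
  ultimately have "cmod (l2_inner S h g) \<le> 0 * l2_norm S g"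
    by (intro tendsto_lowerbound[where F = "at_right (0::real)"]) auto
  then show ?thesis by simp
qed

text \<open>The component is a Hilbert choice, determined only almost everywhere, so it is compared
  with a witness \<open>g\<close> through its norm. The difference of the two lies in
  \<open>V\<close> and is orthogonal to \<open>V\<close>, hence has norm zero.\<close>

lemma l2_norm_orthogonal_component:
  assumes V: "V \<subseteq> l2_space S" and V_diff: "\<And>h k. h \<in> V \<Longrightarrow> k \<in> V \<Longrightarrow> (\<lambda>x. h x - k x) \<in> V"
    and g: "g \<in> l2_space S" "\<And>h. h \<in> V \<Longrightarrow> l2_inner S h g = 0" "(\<lambda>x. f x - g x) \<in> V"
  shows "l2_norm S (l2_orthogonal_component S V f) = l2_norm S g"
proof -
  define k where "k = l2_orthogonal_component S V f"
  have "k \<in> l2_space S \<and> (\<forall>h\<in>V. l2_inner S h k = 0) \<and> (\<lambda>x. f x - k x) \<in> V"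
    unfolding k_def l2_orthogonal_component_def by (rule someI[of _ g]) (use g in auto)
  then have k: "k \<in> l2_space S" "\<And>h. h \<in> V \<Longrightarrow> l2_inner S h k = 0" "(\<lambda>x. f x - k x) \<in> V"
    by auto
  define d where "d = (\<lambda>x. k x - g x)"
  have dV: "d \<in> V"
    using V_diff[OF g(3) k(3)] by (simp add: d_def)
  then have d: "d \<in> l2_space S"
    using V by auto
  have "l2_inner S d d = 0"
    using l2_inner_diff_right[OF d k(1) g(1)] k(2)[OF dV] g(2)[OF dV] by (simp add: d_def)
  then have "(l2_norm S d)\<^sup>2 = 0"
    by (metis l2_inner_self of_real_eq_0_iff)
  moreover have "(l2_norm S (\<lambda>x. g x + d x))\<^sup>2 = (l2_norm S g)\<^sup>2 + (l2_norm S d)\<^sup>2"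
    using l2_norm_sq_add[OF g(1) d] g(2)[OF dV] l2_inner_commute[of S g d] by simp
  moreover have "(\<lambda>x. g x + d x) = k"
    by (simp add: d_def)
  ultimately show ?thesis
    using l2_norm_nonneg[of S g] l2_norm_nonneg[of S k] by (simp add: k_def)
qed

subsection \<open>Eigenspaces of kernel operators\<close>

lemma kernel_operator_scale: "kernel_operator S C (\<lambda>x. c * f x) x = c * kernel_operator S C f x"
  unfolding kernel_operator_def by (simp add: mult.left_commute)

lemma l2_eigenspace_scale:
  assumes "f \<in> l2_eigenspace S (kernel_operator S C) \<kappa>"
  shows "(\<lambda>x. c * f x) \<in> l2_eigenspace S (kernel_operator S C) \<kappa>"
  using assms unfolding l2_eigenspace_def
  by (auto simp: l2_space_scale kernel_operator_scale mult.left_commute)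

text \<open>Scalars pass through a Bochner integral even when it has the default value 0, but
  additivity needs both integrals to exist. This is where the integrability clause of
  \<open>kernel_operator_on_l2\<close> enters, for almost every row of the kernel.\<close>

lemma l2_eigenspace_add:
  assumes "kernel_operator_on_l2 S C"
    and f: "f \<in> l2_eigenspace S (kernel_operator S C) \<kappa>"
    and g: "g \<in> l2_eigenspace S (kernel_operator S C) \<kappa>"
  shows "(\<lambda>x. f x + g x) \<in> l2_eigenspace S (kernel_operator S C) \<kappa>"
proof -
  have "AE x in lebesgue_on S. integrable (lebesgue_on S) (\<lambda>y. C x y * f y)"
    "AE x in lebesgue_on S. integrable (lebesgue_on S) (\<lambda>y. C x y * g y)"
    "AE x in lebesgue_on S. kernel_operator S C f x = complex_of_real \<kappa> * f x"
    "AE x in lebesgue_on S. kernel_operator S C g x = complex_of_real \<kappa> * g x"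
    using assms unfolding kernel_operator_on_l2_def l2_eigenspace_def by auto
  then have "AE x in lebesgue_on S. kernel_operator S C (\<lambda>x. f x + g x) x = complex_of_real \<kappa> * (f x + g x)"
    by eventually_elim (simp add: kernel_operator_def distrib_left)
  then show ?thesis
    using f g unfolding l2_eigenspace_def by (simp add: l2_space_add)
qed

lemma l2_eigenspace_diff:
  assumes "kernel_operator_on_l2 S C"
    and "f \<in> l2_eigenspace S (kernel_operator S C) \<kappa>"
    and "g \<in> l2_eigenspace S (kernel_operator S C) \<kappa>"
  shows "(\<lambda>x. f x - g x) \<in> l2_eigenspace S (kernel_operator S C) \<kappa>"
  using l2_eigenspace_add[OF assms(1,2) l2_eigenspace_scale[OF assms(3), of "-1"]] by simp

lemma l2_eigenspace_combination:
  assumes "kernel_operator_on_l2 S C"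
    and "\<And>n. n \<in> F \<Longrightarrow> f n \<in> l2_eigenspace S (kernel_operator S C) \<kappa>"
  shows "(\<lambda>x. \<Sum>n\<in>F. c n * f n x) \<in> l2_eigenspace S (kernel_operator S C) \<kappa>"
proof -
  have zero: "(\<lambda>x. 0) \<in> l2_eigenspace S (kernel_operator S C) \<kappa>"
    by (simp add: l2_eigenspace_def l2_space_zero kernel_operator_def)
  show ?thesis
    using assms(2)
    by (induction F rule: infinite_finite_induct)
       (simp_all add: zero l2_eigenspace_add[OF assms(1)] l2_eigenspace_scale)
qed

text \<open>Cutting the expansion at the indices of \<open>\<kappa>\<close> splits \<open>f\<close>
  orthogonally: the finite sum is an eigenfunction, and the remainder is orthogonal to a basis of
  the eigenspace because the \<open>a n\<close> are the true coefficients. The scalar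
  \<open>c\<close> is meant to be the norm of the field; for \<open>c = 0\<close> both sides vanish
  by the convention on division.\<close>

lemma l2_norm_eigenspace_component:
  assumes op: "kernel_operator_on_l2 S C"
    and system: "l2_eigen_system S (kernel_operator S C) \<mu> \<phi>"
    and \<kappa>: "\<kappa> > 0" "finite {n. \<mu> n = \<kappa>}"
    and f: "f \<in> l2_space S"
    and lim: "(\<lambda>N. l2_norm S (\<lambda>x. f x - (\<Sum>n<N. a n * \<phi> n x))) \<longlonglongrightarrow> 0"
  shows "l2_norm S (l2_orthogonal_component S (l2_eigenspace S (kernel_operator S C) \<kappa>) (\<lambda>x. f x / c))
    = l2_norm S (\<lambda>x. f x - (\<Sum>n | \<mu> n = \<kappa>. a n * \<phi> n x)) / cmod c"
proof -
  define J where "J = {n. \<mu> n = \<kappa>}"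
  define V where "V = l2_eigenspace S (kernel_operator S C) \<kappa>"
  define p where "p = (\<lambda>x. \<Sum>n\<in>J. a n * \<phi> n x)"
  define g where "g = (\<lambda>x. f x - p x)"
  have V: "V \<subseteq> l2_space S"
    by (auto simp: V_def l2_eigenspace_def)
  have eigen: "\<phi> n \<in> l2_eigenspace S (kernel_operator S C) (\<mu> n)" for n
    using system by (simp add: l2_eigen_system_def)
  then have \<phi>: "\<phi> n \<in> l2_space S" for n
    by (simp add: l2_eigenspace_def)
  have on: "l2_inner S (\<phi> m) (\<phi> n) = (if m = n then 1 else 0)" for m n
    using system by (simp add: l2_eigen_system_def)
  have basis: "l2_orthonormal_basis S V J \<phi>"
    using system \<kappa> by (simp add: l2_eigen_system_def V_def J_def)
  have "p \<in> V"
    unfolding p_def V_def by (rule l2_eigenspace_combination[OF op]) (use eigen in \<open>auto simp: J_def\<close>)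
  then have p: "p \<in> V" "p \<in> l2_space S"
    using V by auto
  have g: "g \<in> l2_space S"
    unfolding g_def by (intro l2_space_diff f p)
  have "l2_inner S (\<phi> n) g = 0" if "n \<in> J" for n
  proof -
    have "l2_inner S (\<phi> n) p = a n"
      using that \<kappa>(2) unfolding p_def
      by (simp add: l2_inner_combination_right \<phi> on J_def if_distrib[of "(*) _"] cong: if_cong)
    then show ?thesis
      using l2_expansion_coefficient[OF \<phi> on f lim, of n]
      by (simp add: g_def l2_inner_diff_right \<phi> f p)
  qed
  then have orth: "l2_inner S h g = 0" if "h \<in> V" for h
    using l2_orthogonal_if_orthogonal_to_basis[OF V basis g _ that] by blast
  have "l2_norm S (l2_orthogonal_component S V (\<lambda>x. f x / c)) = l2_norm S (\<lambda>x. inverse c * g x)"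
  proof (rule l2_norm_orthogonal_component[OF V])
    show "(\<lambda>x. h x - k x) \<in> V" if "h \<in> V" "k \<in> V" for h k
      using l2_eigenspace_diff[OF op] that by (simp add: V_def)
    show "(\<lambda>x. f x / c - inverse c * g x) \<in> V"
      using l2_eigenspace_scale[OF p(1)[unfolded V_def], of "inverse c"]
      by (simp add: g_def V_def divide_inverse algebra_simps)
  qed (simp_all add: l2_space_scale g l2_inner_scale_right orth)
  then show ?thesis
    unfolding l2_norm_scale V_def g_def p_def J_def by (simp add: norm_inverse divide_inverse)
qed

subsection \<open>Gaussian variables\<close>

text \<open>Exponential tilting by a square keeps the density a centred normal one: the variance
  becomes \<open>\<sigma>\<^sup>2 / a\<close>, and the change of normalisation gives the factor
  \<open>1 / sqrt a\<close>.\<close>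

lemma nn_integral_exp_square_normal:
  fixes \<theta> \<sigma> :: real
  assumes X: "distributed M lborel X (normal_density 0 \<sigma>)" and \<sigma>: "\<sigma> > 0" and \<theta>: "2 * \<sigma>\<^sup>2 * \<theta> < 1"
  shows "(\<integral>\<^sup>+\<omega>. ennreal (exp (\<theta> * (X \<omega>)\<^sup>2)) \<partial>M) = ennreal (1 / sqrt (1 - 2 * \<sigma>\<^sup>2 * \<theta>))"
proof -
  define a where "a = 1 - 2 * \<sigma>\<^sup>2 * \<theta>"
  have a: "a > 0"
    using \<theta> by (simp add: a_def)
  define \<tau> where "\<tau> = \<sigma> / sqrt a"
  have \<tau>: "\<tau> > 0" "\<tau>\<^sup>2 = \<sigma>\<^sup>2 / a"
    using \<sigma> a by (simp_all add: \<tau>_def power_divide)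
  have tilt: "normal_density 0 \<sigma> x * exp (\<theta> * x\<^sup>2) = 1 / sqrt a * normal_density 0 \<tau> x" for x
  proof -
    have "- x\<^sup>2 / (2 * \<sigma>\<^sup>2) + \<theta> * x\<^sup>2 = - x\<^sup>2 / (2 * \<tau>\<^sup>2)"
      using \<sigma> a unfolding \<tau>(2) by (simp add: field_simps) (simp add: a_def algebra_simps)
    moreover have "1 / sqrt (2 * pi * \<sigma>\<^sup>2) = 1 / sqrt a * (1 / sqrt (2 * pi * \<tau>\<^sup>2))"
      using a \<sigma> unfolding \<tau>(2) by (simp add: real_sqrt_mult real_sqrt_divide)
    ultimately show ?thesis
      unfolding normal_density_def by (simp add: mult_exp_exp del: real_sqrt_mult)
  qed
  have "(\<integral>\<^sup>+\<omega>. ennreal (exp (\<theta> * (X \<omega>)\<^sup>2)) \<partial>M)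
      = (\<integral>\<^sup>+x. ennreal (normal_density 0 \<sigma> x) * ennreal (exp (\<theta> * x\<^sup>2)) \<partial>lborel)"
    by (rule distributed_nn_integral[OF X, symmetric]) simp
  also have "\<dots> = (\<integral>\<^sup>+x. ennreal (1 / sqrt a) * ennreal (normal_density 0 \<tau> x) \<partial>lborel)"
    using a by (simp add: tilt flip: ennreal_mult)
  also have "\<dots> = ennreal (1 / sqrt a) * (\<integral>\<^sup>+x. ennreal (normal_density 0 \<tau> x) \<partial>lborel)"
    by (rule nn_integral_cmult) simp
  also have "(\<integral>\<^sup>+x. ennreal (normal_density 0 \<tau> x) \<partial>lborel) = 1"
    using \<tau>(1) by (subst nn_integral_eq_integral) auto
  finally show ?thesis
    by (simp add: a_def)
qed

lemma normal_second_moment: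
  assumes "distributed M lborel X (normal_density 0 \<sigma>)" "\<sigma> > 0"
  shows "integrable M (\<lambda>\<omega>. (X \<omega>)\<^sup>2)" "(LINT \<omega>|M. (X \<omega>)\<^sup>2) = \<sigma>\<^sup>2"
proof -
  show "integrable M (\<lambda>\<omega>. (X \<omega>)\<^sup>2)"
    using distributed_integrable[OF assms(1), of "\<lambda>x. x\<^sup>2"] integrable_normal_moment[OF assms(2), of 0 2]
    by simp
  show "(LINT \<omega>|M. (X \<omega>)\<^sup>2) = \<sigma>\<^sup>2"
    using distributed_integral[OF assms(1), of "\<lambda>x. x\<^sup>2"] integral_normal_moment_even[OF assms(2), of 0 1]
    by (simp add: fact_2)
qed

text \<open>Only the unit interval to the right of \<open>sqrt u\<close> is kept, and the density
  there is bounded below by its value at the right end.\<close>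

lemma (in prob_space) normal_square_tail_ge:
  assumes X: "distributed M lborel X (normal_density 0 \<sigma>)" and \<sigma>: "2 * \<sigma>\<^sup>2 = 1" and u: "u \<ge> 0"
  shows "exp (- (sqrt u + 1)\<^sup>2) / sqrt pi \<le> prob {\<omega> \<in> space M. (X \<omega>)\<^sup>2 > u}"
proof -
  define I where "I = {sqrt u<..<sqrt u + 1}"
  have [measurable]: "X \<in> borel_measurable M"
    using distributed_measurable[OF X] by simp
  have density: "exp (- (sqrt u + 1)\<^sup>2) / sqrt pi \<le> normal_density 0 \<sigma> x" if "x \<in> I" for x
  proof -
    have "x\<^sup>2 \<le> (sqrt u + 1)\<^sup>2"
      using that u by (intro power_mono) (auto simp: I_def intro: order_trans[of 0 "sqrt u"])
    moreover have variance: "2 * pi * \<sigma>\<^sup>2 = pi"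
      using \<sigma> by (metis mult.commute mult.left_commute mult_1_right)
    ultimately show ?thesis
      unfolding normal_density_def variance \<sigma> by (simp add: divide_right_mono)
  qed
  have "emeasure lborel I = 1"
    by (simp add: I_def)
  then have "ennreal (exp (- (sqrt u + 1)\<^sup>2) / sqrt pi)
      = (\<integral>\<^sup>+x. ennreal (exp (- (sqrt u + 1)\<^sup>2) / sqrt pi) * indicator I x \<partial>lborel)"
    by (simp add: nn_integral_cmult_indicator I_def)
  also have "\<dots> \<le> (\<integral>\<^sup>+x. ennreal (normal_density 0 \<sigma> x) * indicator I x \<partial>lborel)"
    using density by (intro nn_integral_mono) (auto split: split_indicator intro: ennreal_leI)
  also have "\<dots> = emeasure M (X -` I \<inter> space M)"
    by (rule distributed_emeasure[OF X, symmetric]) (simp add: I_def)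
  also have "\<dots> \<le> emeasure M {\<omega> \<in> space M. (X \<omega>)\<^sup>2 > u}"
  proof (rule emeasure_mono)
    have "u < x\<^sup>2" if "sqrt u < x" for x
      using that u by (metis real_less_rsqrt real_sqrt_abs real_sqrt_less_iff abs_ge_self order_less_le_trans)
    then show "X -` I \<inter> space M \<subseteq> {\<omega> \<in> space M. (X \<omega>)\<^sup>2 > u}"
      by (auto simp: I_def)
  qed measurable
  finally show ?thesis
    by (simp add: emeasure_eq_measure)
qed

lemma (in prob_space) indep_var_nn_integral:
  fixes X Y :: "'a \<Rightarrow> ennreal"
  assumes "indep_var borel X borel Y"
  shows "(\<integral>\<^sup>+\<omega>. X \<omega> * Y \<omega> \<partial>M) = (\<integral>\<^sup>+\<omega>. X \<omega> \<partial>M) * (\<integral>\<^sup>+\<omega>. Y \<omega> \<partial>M)"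
proof -
  \<comment> \<open>\<open>indep_var\<close> is \<open>indep_vars\<close> over the booleans, with
    the target spaces given by \<open>case_bool\<close>; they have to be recognised as one constant
    family.\<close>
  have "case_bool borel borel = (\<lambda>_. borel :: ennreal measure)"
    by (simp add: fun_eq_iff split: bool.split)
  then have "indep_vars (\<lambda>_. borel) (case_bool X Y) UNIV"
    using assms by (simp add: indep_var_def)
  from indep_vars_nn_integral[OF _ this] show ?thesis
    by (simp add: UNIV_bool mult.commute)
qed

text \<open>\<open>circular_complex_gaussian\<close> leaves the variance open; the unit second
  moment is shared equally by the real and imaginary parts.\<close>

lemma (in prob_space) circular_gaussian_components:
  assumes Z: "circular_complex_gaussian M Z" and unit: "(LINT \<omega>|M. cnj (Z \<omega>) * Z \<omega>) = 1"
  obtains \<sigma> where "\<sigma> > 0" "2 * \<sigma>\<^sup>2 = 1"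
    "distributed M lborel (\<lambda>\<omega>. Re (Z \<omega>)) (normal_density 0 \<sigma>)"
    "distributed M lborel (\<lambda>\<omega>. Im (Z \<omega>)) (normal_density 0 \<sigma>)"
proof -
  from Z obtain \<sigma> where \<sigma>: "\<sigma> > 0"
    and Re: "distributed M lborel (\<lambda>\<omega>. Re (Z \<omega>)) (normal_density 0 \<sigma>)"
    and Im: "distributed M lborel (\<lambda>\<omega>. Im (Z \<omega>)) (normal_density 0 \<sigma>)"
    unfolding circular_complex_gaussian_def by blast
  have "cnj z * z = complex_of_real ((Re z)\<^sup>2 + (Im z)\<^sup>2)" for z
    by (simp add: complex_eq_iff power2_eq_square)
  then have "complex_of_real (LINT \<omega>|M. (Re (Z \<omega>))\<^sup>2 + (Im (Z \<omega>))\<^sup>2) = 1"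
    using unit by (simp only: integral_complex_of_real)
  then have "(LINT \<omega>|M. (Re (Z \<omega>))\<^sup>2 + (Im (Z \<omega>))\<^sup>2) = 1"
    by (simp only: of_real_eq_1_iff)
  then have "2 * \<sigma>\<^sup>2 = 1"
    using normal_second_moment[OF Re \<sigma>] normal_second_moment[OF Im \<sigma>] by simp
  with that \<sigma> Re Im show ?thesis by blast
qed

text \<open>The squared modulus is a sum of two independent squares, each contributing the factor
  \<open>1 / sqrt (1 - \<theta>)\<close>. The result is the transform of the exponential law of rate
  one.\<close>

lemma (in prob_space) nn_integral_exp_circular_gaussian:
  assumes Z: "circular_complex_gaussian M Z" and unit: "(LINT \<omega>|M. cnj (Z \<omega>) * Z \<omega>) = 1"
    and \<theta>: "\<theta> < 1"
  shows "(\<integral>\<^sup>+\<omega>. ennreal (exp (\<theta> * (cmod (Z \<omega>))\<^sup>2)) \<partial>M) = ennreal (1 / (1 - \<theta>))"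
proof -
  from circular_gaussian_components[OF Z unit] obtain \<sigma> where \<sigma>: "\<sigma> > 0" "2 * \<sigma>\<^sup>2 = 1"
    and Re: "distributed M lborel (\<lambda>\<omega>. Re (Z \<omega>)) (normal_density 0 \<sigma>)"
    and Im: "distributed M lborel (\<lambda>\<omega>. Im (Z \<omega>)) (normal_density 0 \<sigma>)" .
  have "indep_var borel (\<lambda>\<omega>. Re (Z \<omega>)) borel (\<lambda>\<omega>. Im (Z \<omega>))"
    using Z by (simp add: circular_complex_gaussian_def)
  from indep_var_compose[OF this, of "\<lambda>x. ennreal (exp (\<theta> * x\<^sup>2))" borel "\<lambda>x. ennreal (exp (\<theta> * x\<^sup>2))" borel]
  have indep: "indep_var borel (\<lambda>\<omega>. ennreal (exp (\<theta> * (Re (Z \<omega>))\<^sup>2))) borel (\<lambda>\<omega>. ennreal (exp (\<theta> * (Im (Z \<omega>))\<^sup>2)))"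
    by (simp add: comp_def)
  have "(\<integral>\<^sup>+\<omega>. ennreal (exp (\<theta> * (cmod (Z \<omega>))\<^sup>2)) \<partial>M)
      = (\<integral>\<^sup>+\<omega>. ennreal (exp (\<theta> * (Re (Z \<omega>))\<^sup>2)) * ennreal (exp (\<theta> * (Im (Z \<omega>))\<^sup>2)) \<partial>M)"
    by (simp add: cmod_power2 distrib_left exp_add ennreal_mult)
  also have "\<dots> = ennreal (1 / sqrt (1 - \<theta>)) * ennreal (1 / sqrt (1 - \<theta>))"
    using nn_integral_exp_square_normal[OF Re \<sigma>(1), of \<theta>] nn_integral_exp_square_normal[OF Im \<sigma>(1), of \<theta>]
      indep_var_nn_integral[OF indep] \<theta> unfolding \<sigma>(2) by simp
  also have "\<dots> = ennreal (1 / (1 - \<theta>))"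
    using \<theta> by (simp flip: ennreal_mult)
  finally show ?thesis .
qed

text \<open>The imaginary part is dropped. Compared with the exact tail \<open>exp (- u)\<close>
  this loses only a factor of order \<open>exp (2 * sqrt u)\<close>, harmless against a gain
  exponential in \<open>u\<close>.\<close>

lemma (in prob_space) circular_gaussian_tail_ge:
  assumes Z: "circular_complex_gaussian M Z" and unit: "(LINT \<omega>|M. cnj (Z \<omega>) * Z \<omega>) = 1"
    and [measurable]: "Z \<in> borel_measurable M" and u: "u \<ge> 0"
  shows "exp (- (sqrt u + 1)\<^sup>2) / sqrt pi \<le> prob {\<omega> \<in> space M. (cmod (Z \<omega>))\<^sup>2 > u}"
proof -
  from circular_gaussian_components[OF Z unit] obtain \<sigma> where \<sigma>: "\<sigma> > 0" "2 * \<sigma>\<^sup>2 = 1"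
    and Re: "distributed M lborel (\<lambda>\<omega>. Re (Z \<omega>)) (normal_density 0 \<sigma>)"
    and Im: "distributed M lborel (\<lambda>\<omega>. Im (Z \<omega>)) (normal_density 0 \<sigma>)" .
  have "(Re z)\<^sup>2 \<le> (cmod z)\<^sup>2" for z
    by (simp add: cmod_power2)
  then have "prob {\<omega> \<in> space M. (Re (Z \<omega>))\<^sup>2 > u} \<le> prob {\<omega> \<in> space M. (cmod (Z \<omega>))\<^sup>2 > u}"
    by (intro finite_measure_mono) (auto intro: order_less_le_trans)
  then show ?thesis
    using normal_square_tail_ge[OF Re \<sigma>(2) u] by linarith
qed

subsection \<open>Weighted sums of independent exponential variables\<close>

text \<open>The exponential law enters through its moment generating function, stated as a
  nonnegative integral so that finiteness for \<open>\<theta> < 1\<close> is part of it.\<close>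

locale independent_exponentials = prob_space +
  fixes X :: "nat \<Rightarrow> 'a \<Rightarrow> real"
  assumes indep: "indep_vars (\<lambda>_. borel) X UNIV"
    and nonneg: "\<And>n \<omega>. 0 \<le> X n \<omega>"
    and mgf: "\<And>n \<theta>. \<theta> < 1 \<Longrightarrow> (\<integral>\<^sup>+\<omega>. ennreal (exp (\<theta> * X n \<omega>)) \<partial>M) = ennreal (1 / (1 - \<theta>))"
begin

lemma measurable_X [measurable]: "X n \<in> borel_measurable M"
  using indep by (simp add: indep_vars_def)

lemma mgf_weighted_sum:
  fixes \<alpha> :: "nat \<Rightarrow> real"
  assumes "\<And>n. \<alpha> n < 1"
  shows "(\<integral>\<^sup>+\<omega>. ennreal (exp (\<Sum>n<N. \<alpha> n * X n \<omega>)) \<partial>M) = ennreal (\<Prod>n<N. 1 / (1 - \<alpha> n))"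
proof -
  have "indep_vars (\<lambda>_. borel) X {..<N}"
    using indep by (rule indep_vars_subset) simp
  then have indep': "indep_vars (\<lambda>_. borel) (\<lambda>n \<omega>. ennreal (exp (\<alpha> n * X n \<omega>))) {..<N}"
    by (rule indep_vars_compose2[where Y = "\<lambda>n x. ennreal (exp (\<alpha> n * x))"]) measurable
  have "(\<integral>\<^sup>+\<omega>. ennreal (exp (\<Sum>n<N. \<alpha> n * X n \<omega>)) \<partial>M)
      = (\<integral>\<^sup>+\<omega>. (\<Prod>n<N. ennreal (exp (\<alpha> n * X n \<omega>))) \<partial>M)"
    by (simp add: exp_sum prod_ennreal)
  also have "\<dots> = (\<Prod>n<N. ennreal (1 / (1 - \<alpha> n)))"
    using indep_vars_nn_integral[OF _ indep'] assms by (simp add: mgf)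
  also have "\<dots> = ennreal (\<Prod>n<N. 1 / (1 - \<alpha> n))"
    using assms by (intro prod_ennreal) (simp add: less_imp_le)
  finally show ?thesis .
qed

text \<open>Each factor \<open>1 / (1 - \<alpha> n)\<close> is at most the exponential of a summable
  term, so the bound is uniform in \<open>N\<close> and survives the passage to the series. The
  weights may have either sign.\<close>

lemma mgf_weighted_sum_le:
  fixes \<alpha> :: "nat \<Rightarrow> real"
  assumes \<alpha>: "\<And>n. \<alpha> n \<le> q" and q: "q < 1" and summable: "summable (\<lambda>n. \<bar>\<alpha> n\<bar>)"
  shows "(\<integral>\<^sup>+\<omega>. ennreal (exp (\<Sum>n<N. \<alpha> n * X n \<omega>)) \<partial>M) \<le> ennreal (exp ((\<Sum>n. \<bar>\<alpha> n\<bar>) / (1 - q)))"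
proof -
  have lt: "\<alpha> n < 1" for n
    using \<alpha>[of n] q by simp
  have factor: "1 / (1 - \<alpha> n) \<le> exp (\<bar>\<alpha> n\<bar> / (1 - q))" for n
  proof -
    have "1 / (1 - \<alpha> n) = 1 + \<alpha> n / (1 - \<alpha> n)"
      using lt[of n] by (simp add: field_simps)
    also have "\<dots> \<le> 1 + \<bar>\<alpha> n\<bar> / (1 - q)"
      using \<alpha>[of n] q by (intro add_left_mono frac_le) auto
    also have "\<dots> \<le> exp (\<bar>\<alpha> n\<bar> / (1 - q))"
      by (rule exp_ge_add_one_self)
    finally show ?thesis .
  qed
  have "(\<Prod>n<N. 1 / (1 - \<alpha> n)) \<le> (\<Prod>n<N. exp (\<bar>\<alpha> n\<bar> / (1 - q)))"
    using factor lt by (intro prod_mono) (auto simp: less_imp_le)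
  also have "\<dots> = exp ((\<Sum>n<N. \<bar>\<alpha> n\<bar>) / (1 - q))"
    by (simp add: exp_sum sum_divide_distrib)
  also have "\<dots> \<le> exp ((\<Sum>n. \<bar>\<alpha> n\<bar>) / (1 - q))"
    using summable q by (intro exp_mono divide_right_mono sum_le_suminf) auto
  finally show ?thesis
    unfolding mgf_weighted_sum[OF lt] by (rule ennreal_leI)
qed

text \<open>Chernoff's bound for the infinite series: \<open>exp c\<close> is below the limit of the
  exponentials of the partial sums on \<open>E\<close>, and Fatou moves the limit outside. Weights
  of mixed sign rule out monotone convergence.\<close>

lemma prob_weighted_series_ge:
  fixes \<alpha> :: "nat \<Rightarrow> real"
  assumes \<alpha>: "\<And>n. \<alpha> n \<le> q" and q: "q < 1" and summable: "summable (\<lambda>n. \<bar>\<alpha> n\<bar>)"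
    and E: "E \<in> events"
    and large: "AE \<omega> in M. \<omega> \<in> E \<longrightarrow> (\<exists>d\<ge>c. (\<lambda>n. \<alpha> n * X n \<omega>) sums d)"
  shows "prob E \<le> exp ((\<Sum>n. \<bar>\<alpha> n\<bar>) / (1 - q)) * exp (- c)"
proof -
  define K where "K = exp ((\<Sum>n. \<bar>\<alpha> n\<bar>) / (1 - q))"
  have "ennreal (exp c * prob E) = (\<integral>\<^sup>+\<omega>. ennreal (exp c) * indicator E \<omega> \<partial>M)"
    using E by (simp add: nn_integral_cmult_indicator emeasure_eq_measure ennreal_mult)
  \<comment> \<open>The lower limit makes sense at every point, also off \<open>E\<close>, where the
    series need not converge.\<close>
  also have "\<dots> \<le> (\<integral>\<^sup>+\<omega>. liminf (\<lambda>N. ennreal (exp (\<Sum>n<N. \<alpha> n * X n \<omega>))) \<partial>M)"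
  proof (rule nn_integral_mono_AE)
    show "AE \<omega> in M. ennreal (exp c) * indicator E \<omega> \<le> liminf (\<lambda>N. ennreal (exp (\<Sum>n<N. \<alpha> n * X n \<omega>)))"
      using large
    proof eventually_elim
      case (elim \<omega>)
      show ?case
      proof (cases "\<omega> \<in> E")
        case True
        with elim obtain d where d: "d \<ge> c" "(\<lambda>n. \<alpha> n * X n \<omega>) sums d"
          by blast
        then have "(\<lambda>N. ennreal (exp (\<Sum>n<N. \<alpha> n * X n \<omega>))) \<longlonglongrightarrow> ennreal (exp d)"
          unfolding sums_def by (intro tendsto_intros)
        then have "liminf (\<lambda>N. ennreal (exp (\<Sum>n<N. \<alpha> n * X n \<omega>))) = ennreal (exp d)"
          by (rule lim_imp_Liminf[rotated]) simp
        with True d(1) show ?thesis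
          by (simp add: ennreal_leI)
      qed simp
    qed
  qed
  also have "\<dots> \<le> liminf (\<lambda>N. \<integral>\<^sup>+\<omega>. ennreal (exp (\<Sum>n<N. \<alpha> n * X n \<omega>)) \<partial>M)"
    by (rule nn_integral_liminf) measurable
  also have "\<dots> \<le> liminf (\<lambda>N. ennreal K)"
    unfolding K_def by (intro Liminf_mono always_eventually allI mgf_weighted_sum_le assms)
  also have "\<dots> = ennreal K"
    by (simp add: Liminf_const)
  finally have "exp c * prob E \<le> K"
    by (simp add: K_def)
  then show ?thesis
    unfolding K_def[symmetric] by (simp add: exp_minus field_simps)
qed

text \<open>
  The Laplace transforms \<open>\<Prod> 1 / (1 + \<mu>\<^sub>n)\<close> of the partial sums stay above the one of the series,
  which is positive.
\<close>

lemma summable_weights: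
  fixes \<mu> :: "nat \<Rightarrow> real"
  assumes \<mu>: "\<And>n. 0 \<le> \<mu> n" and summable: "AE \<omega> in M. summable (\<lambda>n. \<mu> n * X n \<omega>)"
  shows "summable \<mu>"
proof -
  define c where "c = (\<integral>\<^sup>+\<omega>. ennreal (exp (- (\<Sum>n. \<mu> n * X n \<omega>))) \<partial>M)"
  \<comment> \<open>The integrand is the exponential of a real number, hence positive everywhere; a
    zero integral would make the whole probability space null.\<close>
  have "c \<noteq> 0"
  proof
    assume "c = 0"
    moreover have "(\<lambda>\<omega>. ennreal (exp (- (\<Sum>n. \<mu> n * X n \<omega>)))) \<in> borel_measurable M"
      by (intro measurable_compose[OF _ measurable_ennreal] borel_measurable_exp borel_measurable_uminus
          borel_measurable_suminf) measurable
    ultimately have "AE \<omega> in M. ennreal (exp (- (\<Sum>n. \<mu> n * X n \<omega>))) = 0"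
      unfolding c_def by (simp only: nn_integral_0_iff_AE)
    then have "AE \<omega> in M. False"
      by (simp add: ennreal_eq_0_iff not_le)
    then show False by simp
  qed
  have upper: "c \<le> ennreal (1 / (1 + (\<Sum>n<N. \<mu> n)))" for N
  proof -
    have "c \<le> (\<integral>\<^sup>+\<omega>. ennreal (exp (\<Sum>n<N. - \<mu> n * X n \<omega>)) \<partial>M)"
      unfolding c_def
    proof (rule nn_integral_mono_AE)
      show "AE \<omega> in M. ennreal (exp (- (\<Sum>n. \<mu> n * X n \<omega>))) \<le> ennreal (exp (\<Sum>n<N. - \<mu> n * X n \<omega>))"
        using summable
      proof eventually_elim
        case (elim \<omega>)
        then have "(\<Sum>n<N. \<mu> n * X n \<omega>) \<le> (\<Sum>n. \<mu> n * X n \<omega>)"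
          by (rule sum_le_suminf) (auto simp: \<mu> nonneg)
        then show ?case
          by (intro ennreal_leI) (simp add: sum_negf)
      qed
    qed
    also have "\<dots> = ennreal (\<Prod>n<N. 1 / (1 - - \<mu> n))"
    proof (rule mgf_weighted_sum)
      show "- \<mu> n < 1" for n
        using \<mu>[of n] by simp
    qed
    also have "\<dots> \<le> ennreal (1 / (1 + (\<Sum>n<N. \<mu> n)))"
    proof (rule ennreal_leI)
      \<comment> \<open>Expanding the product of nonnegative terms gives at least its constant and
        linear parts. This turns the product bound into one on the partial sums of
        \<open>\<mu>\<close>.\<close>
      have "1 + (\<Sum>n<N. \<mu> n) \<le> (\<Prod>n<N. 1 + \<mu> n)"
      proof (induction N)
        case (Suc N)
        have "1 + (\<Sum>n<Suc N. \<mu> n) \<le> (1 + (\<Sum>n<N. \<mu> n)) * (1 + \<mu> N)"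
          using \<mu> by (simp add: distrib_left distrib_right sum_nonneg)
        also have "\<dots> \<le> (\<Prod>n<N. 1 + \<mu> n) * (1 + \<mu> N)"
          using Suc \<mu> by (intro mult_right_mono) auto
        finally show ?case by simp
      qed simp
      moreover have "0 < 1 + (\<Sum>n<N. \<mu> n)"
        using \<mu> by (simp add: add_pos_nonneg sum_nonneg)
      ultimately show "(\<Prod>n<N. 1 / (1 - - \<mu> n)) \<le> 1 / (1 + (\<Sum>n<N. \<mu> n))"
        by (simp add: prod_dividef frac_le)
    qed
    finally show ?thesis .
  qed
  have "c < top"
    using upper[of 0] by (simp add: order_le_less_trans)
  with \<open>c \<noteq> 0\<close> obtain b where b: "c = ennreal b" "b > 0"
    by (cases c) (auto simp: ennreal_eq_0_iff not_le)
  have "(\<Sum>n<N. \<mu> n) \<le> 1 / b" for N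
  proof -
    have pos: "0 < 1 + (\<Sum>n<N. \<mu> n)"
      using \<mu> by (simp add: add_pos_nonneg sum_nonneg)
    then have "b \<le> 1 / (1 + (\<Sum>n<N. \<mu> n))"
      using upper[of N] unfolding b(1) by (subst (asm) ennreal_le_iff) auto
    then have "1 + (\<Sum>n<N. \<mu> n) \<le> 1 / b"
      using b(2) pos by (simp add: field_simps)
    then show ?thesis by simp
  qed
  with \<mu> show ?thesis
    by (rule summableI_nonneg_bounded)
qed

text \<open>\<open>A\<close> and \<open>B\<close> stand for the squared norms of the field and of
  its residual, and \<open>e\<close> for the squared threshold. The condition \<open>P\<close>
  enters the estimate only through an inequality between them, which keeps the geometry of the
  eigenspace out of the probabilistic argument.\<close>

lemma cond_prob_subleading_tendsto_0:
  fixes \<mu> :: "nat \<Rightarrow> real"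
  assumes \<mu>: "\<And>n. 0 \<le> \<mu> n" "summable \<mu>"
    and J: "0 \<in> J" "\<And>n. n \<in> J \<Longrightarrow> \<mu> n = \<kappa>" "\<And>n. n \<notin> J \<Longrightarrow> \<mu> n \<le> q"
    and q: "0 \<le> q" "q < \<kappa>" and e: "e > 0"
    and tail: "\<And>u. u \<ge> 0 \<Longrightarrow> exp (- (sqrt u + 1)\<^sup>2) / sqrt pi \<le> prob {\<omega> \<in> space M. X 0 \<omega> > u}"
    and A: "AE \<omega> in M. (\<lambda>n. \<mu> n * X n \<omega>) sums A \<omega>"
    and B: "AE \<omega> in M. (\<lambda>n. if n \<in> J then 0 else \<mu> n * X n \<omega>) sums B \<omega>"
    and P: "AE \<omega> in M. P \<omega> \<longrightarrow> A \<omega> > 0 \<longrightarrow> B \<omega> \<ge> e * A \<omega>"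
  shows "((\<lambda>r. cond_prob M P (\<lambda>\<omega>. A \<omega> > r)) \<longlongrightarrow> 0) at_top"
proof -
  have \<kappa>: "\<kappa> > 0"
    using q by simp
  \<comment> \<open>chosen so that \<open>(1 / \<kappa> + t) * q\<close> stays below \<open>1\<close>\<close>
  define t where "t = (\<kappa> - q) / (2 * \<kappa>\<^sup>2)"
  have t: "t > 0"
    using q \<kappa> by (simp add: t_def)
  \<comment> \<open>The excess \<open>t * e / 2\<close> over \<open>1 / \<kappa>\<close> is the
    exponential gain. The series with weights \<open>\<alpha>\<close> has the sum
    \<open>l * A + t * (B - e * A)\<close>.\<close>
  define l where "l = 1 / \<kappa> + t * e / 2"
  define \<alpha> where "\<alpha> n = (l - t * e) * \<mu> n + t * (if n \<in> J then 0 else \<mu> n)" for n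
  \<comment> \<open>The first entry is the common value of \<open>\<alpha>\<close> on
    \<open>J\<close>; the second bounds \<open>\<alpha>\<close> off \<open>J\<close> and is below 1
    by the spectral gap.\<close>
  define p where "p = max (1 - t * e * \<kappa> / 2) ((\<kappa> + q) / (2 * \<kappa>))"
  have p: "p < 1"
    using t e \<kappa> q by (simp add: p_def field_simps)
  have \<alpha>_le: "\<alpha> n \<le> p" for n
  proof (cases "n \<in> J")
    case True
    then have "\<alpha> n = 1 - t * e * \<kappa> / 2"
      using J(2)[OF True] \<kappa> by (simp add: \<alpha>_def l_def field_simps)
    then show ?thesis by (simp add: p_def)
  next
    case False
    have "\<alpha> n = (1 / \<kappa> + t) * \<mu> n - t * e / 2 * \<mu> n"
      using False by (simp add: \<alpha>_def l_def algebra_simps)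
    also have "\<dots> \<le> (1 / \<kappa> + t) * \<mu> n"
      using t e \<mu>(1)[of n] by simp
    also have "\<dots> \<le> (1 / \<kappa> + t) * q"
      using t \<kappa> J(3)[OF False] by (intro mult_left_mono) auto
    also have "\<dots> = q / \<kappa> + t * q"
      by (simp add: distrib_right)
    also have "\<dots> \<le> q / \<kappa> + t * \<kappa>"
      using t q by (intro add_left_mono mult_left_mono) auto
    also have "\<dots> = (\<kappa> + q) / (2 * \<kappa>)"
      using \<kappa> by (simp add: t_def power2_eq_square field_simps)
    finally show ?thesis by (simp add: p_def)
  qed
  have "summable (\<lambda>n. \<bar>\<alpha> n\<bar>)"
  proof (rule summable_comparison_test')
    show "summable (\<lambda>n. (\<bar>l - t * e\<bar> + t) * \<mu> n)"
      using \<mu>(2) by (rule summable_mult)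
    show "norm \<bar>\<alpha> n\<bar> \<le> (\<bar>l - t * e\<bar> + t) * \<mu> n" for n
    proof -
      have "\<bar>\<alpha> n\<bar> \<le> \<bar>(l - t * e) * \<mu> n\<bar> + \<bar>t * (if n \<in> J then 0 else \<mu> n)\<bar>"
        unfolding \<alpha>_def by (rule abs_triangle_ineq)
      also have "\<dots> \<le> \<bar>l - t * e\<bar> * \<mu> n + t * \<mu> n"
        using \<mu>(1)[of n] t by (intro add_mono) (auto simp: abs_mult)
      finally show ?thesis
        by (simp add: distrib_right)
    qed
  qed
  note \<alpha> = \<alpha>_le p this
  define K where "K = exp ((\<Sum>n. \<bar>\<alpha> n\<bar>) / (1 - p))"
  \<comment> \<open>Chernoff's bound for the joint event, divided by the lower bound for the
    conditioning event that comes from \<open>X 0\<close> alone.\<close>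
  define bound where "bound r = K * exp (- (l * r)) / (exp (- (sqrt (r / \<kappa>) + 1)\<^sup>2) / sqrt pi)" for r
  have upper: "cond_prob M P (\<lambda>\<omega>. A \<omega> > r) \<le> bound r" if r: "r > 0" for r
  proof (cases "{\<omega> \<in> space M. P \<omega> \<and> A \<omega> > r} \<in> events \<and> {\<omega> \<in> space M. A \<omega> > r} \<in> events")
    case False
    \<comment> \<open>nonmeasurable sets have measure \<open>0\<close>, and \<open>x / 0 = 0\<close>\<close>
    then have "cond_prob M P (\<lambda>\<omega>. A \<omega> > r) = 0"
      by (auto simp: cond_prob_def measure_notin_sets)
    then show ?thesis
      by (simp add: bound_def K_def)
  next
    case True
    have "prob {\<omega> \<in> space M. P \<omega> \<and> A \<omega> > r} \<le> K * exp (- (l * r))"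
      unfolding K_def
    proof (rule prob_weighted_series_ge[OF \<alpha>])
      show "AE \<omega> in M. \<omega> \<in> {\<omega> \<in> space M. P \<omega> \<and> A \<omega> > r} \<longrightarrow> (\<exists>d\<ge>l * r. (\<lambda>n. \<alpha> n * X n \<omega>) sums d)"
        using A B P
      proof eventually_elim
        case (elim \<omega>)
        have "(\<lambda>n. (l - t * e) * (\<mu> n * X n \<omega>) + t * (if n \<in> J then 0 else \<mu> n * X n \<omega>))
            sums ((l - t * e) * A \<omega> + t * B \<omega>)"
          using elim by (intro sums_add sums_mult) auto
        also have "(\<lambda>n. (l - t * e) * (\<mu> n * X n \<omega>) + t * (if n \<in> J then 0 else \<mu> n * X n \<omega>))
            = (\<lambda>n. \<alpha> n * X n \<omega>)"
          by (auto simp: \<alpha>_def algebra_simps)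
        finally have "(\<lambda>n. \<alpha> n * X n \<omega>) sums ((l - t * e) * A \<omega> + t * B \<omega>)" .
        moreover have "l * r \<le> (l - t * e) * A \<omega> + t * B \<omega>" if "P \<omega>" "A \<omega> > r"
        proof -
          have "t * (e * A \<omega>) \<le> t * B \<omega>"
            using elim that r t by (intro mult_left_mono) auto
          moreover have "l * r \<le> l * A \<omega>"
            using that t e \<kappa> by (intro mult_left_mono) (auto simp: l_def)
          ultimately show ?thesis
            by (simp add: algebra_simps)
        qed
        ultimately show ?case by blast
      qed
    qed (use True in simp)
    moreover have "exp (- (sqrt (r / \<kappa>) + 1)\<^sup>2) / sqrt pi \<le> prob {\<omega> \<in> space M. A \<omega> > r}"
    proof -
      have "prob {\<omega> \<in> space M. X 0 \<omega> > r / \<kappa>} \<le> prob {\<omega> \<in> space M. A \<omega> > r}"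
      proof (rule finite_measure_mono_AE)
        show "AE \<omega> in M. \<omega> \<in> {\<omega> \<in> space M. X 0 \<omega> > r / \<kappa>} \<longrightarrow> \<omega> \<in> {\<omega> \<in> space M. A \<omega> > r}"
          using A
        proof eventually_elim
          case (elim \<omega>)
          \<comment> \<open>All terms are nonnegative, so the term of index 0, which belongs to
            \<open>J\<close>, bounds the series from below.\<close>
          have "(\<Sum>n\<in>{0}. \<mu> n * X n \<omega>) \<le> (\<Sum>n. \<mu> n * X n \<omega>)"
            using sums_summable[OF elim] by (rule sum_le_suminf) (auto simp: \<mu> nonneg)
          then have "\<kappa> * X 0 \<omega> \<le> A \<omega>"
            using sums_unique[OF elim] J(1,2) by simp
          then show ?case
            using \<kappa> by (auto simp: field_simps)
        qed
      qed (use True in simp)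
      then show ?thesis
        using tail[of "r / \<kappa>"] r \<kappa> by simp
    qed
    ultimately show ?thesis
      unfolding cond_prob_def bound_def by (intro frac_le) (auto simp: K_def)
  qed
  have bound_lim: "(bound \<longlongrightarrow> 0) at_top"
  proof -
    define \<eta> where "\<eta> = t * e / 2"
    have \<eta>: "\<eta> > 0"
      using t e by (simp add: \<eta>_def)
    have "bound r = K * sqrt pi * exp (1 + 2 * sqrt (r / \<kappa>) - \<eta> * r)" if "r > 0" for r
    proof -
      \<comment> \<open>The terms \<open>r / \<kappa>\<close> cancel; what remains is a linear decay
        against a growth of order \<open>sqrt r\<close>.\<close>
      have "- (l * r) + (sqrt (r / \<kappa>) + 1)\<^sup>2 = 1 + 2 * sqrt (r / \<kappa>) - \<eta> * r"
        using that \<kappa> by (simp add: power2_sum l_def \<eta>_def algebra_simps)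
      then have "exp (- (l * r)) * exp ((sqrt (r / \<kappa>) + 1)\<^sup>2) = exp (1 + 2 * sqrt (r / \<kappa>) - \<eta> * r)"
        by (simp only: mult_exp_exp)
      then show ?thesis
        unfolding bound_def exp_minus[of "(sqrt (r / \<kappa>) + 1)\<^sup>2"] by (simp add: field_simps)
    qed
    then have "eventually (\<lambda>r. K * sqrt pi * exp (1 + 2 * sqrt (r / \<kappa>) - \<eta> * r) = bound r) at_top"
      by (intro eventually_mono[OF eventually_gt_at_top[of 0]]) simp
    moreover have "((\<lambda>r. K * sqrt pi * exp (1 + 2 * sqrt (r / \<kappa>) - \<eta> * r)) \<longlongrightarrow> 0) at_top"
      using \<kappa> \<eta> by real_asymp
    ultimately show ?thesis
      by (rule Lim_transform_eventually[rotated])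
  qed
  show ?thesis
  proof (rule tendsto_sandwich[OF _ _ tendsto_const bound_lim])
    show "eventually (\<lambda>r. cond_prob M P (\<lambda>\<omega>. A \<omega> > r) \<le> bound r) at_top"
      using eventually_gt_at_top[of 0] by eventually_elim (rule upper)
    show "eventually (\<lambda>r. 0 \<le> cond_prob M P (\<lambda>\<omega>. A \<omega> > r)) at_top"
      by (simp add: cond_prob_def)
  qed
qed

end

section \<open>The conditional limit for the Gaussian field\<close>

theorem proposition1:
  fixes \<Lambda> :: "(real ^ 'd) set"
    and M :: "'w measure"
    and \<Phi> :: "'w \<Rightarrow> real ^ 'd \<Rightarrow> complex"
    and C :: "real ^ 'd \<Rightarrow> real ^ 'd \<Rightarrow> complex"
    and s :: "nat \<Rightarrow> 'w \<Rightarrow> complex"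
    and \<mu> :: "nat \<Rightarrow> real"
    and \<phi> :: "nat \<Rightarrow> real ^ 'd \<Rightarrow> complex"
    and \<kappa>\<^sub>1 \<epsilon> :: real
  defines "T\<^sub>C \<equiv> kernel_operator \<Lambda> C"
  assumes "bounded \<Lambda>" and "\<Lambda> \<in> sets lebesgue"
    and "prob_space M"
    (* the zero mean complex Gaussian field and its covariance *)
    and "(\<lambda>(\<omega>, x). \<Phi> \<omega> x) \<in> borel_measurable (M \<Otimes>\<^sub>M lebesgue_on \<Lambda>)"
    and "complex_gaussian_field M \<Lambda> (\<lambda>x \<omega>. \<Phi> \<omega> x)"
    and "\<And>x. x \<in> \<Lambda> \<Longrightarrow> (LINT \<omega>|M. \<Phi> \<omega> x) = 0"
    and "\<And>x y. x \<in> \<Lambda> \<Longrightarrow> y \<in> \<Lambda> \<Longrightarrow> (LINT \<omega>|M. \<Phi> \<omega> x * \<Phi> \<omega> y) = 0"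
    and "\<And>x y. x \<in> \<Lambda> \<Longrightarrow> y \<in> \<Lambda> \<Longrightarrow> (LINT \<omega>|M. \<Phi> \<omega> x * cnj (\<Phi> \<omega> y)) = C x y"
    (* the covariance operator, its eigenvalues and eigenfunctions *)
    and "kernel_operator_on_l2 \<Lambda> C"
    and "l2_nonneg_self_adjoint \<Lambda> T\<^sub>C"
    and "l2_eigen_system \<Lambda> T\<^sub>C \<mu> \<phi>"
    and "\<kappa>\<^sub>1 \<in> l2_eigenvalues \<Lambda> T\<^sub>C" and "\<And>\<kappa>. \<kappa> \<in> l2_eigenvalues \<Lambda> T\<^sub>C \<Longrightarrow> \<kappa> \<le> \<kappa>\<^sub>1" and "\<kappa>\<^sub>1 > 0"
    (* the i.i.d. circularly symmetric complex Gaussian coefficients *)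
    and "prob_space.indep_vars M (\<lambda>_. borel) s UNIV"
    and "\<And>n. distr M borel (s n) = distr M borel (s 0)"
    and "\<And>n. circular_complex_gaussian M (s n)"
    and "\<And>n. (LINT \<omega>|M. s n \<omega>) = 0"
    and "\<And>n m. (LINT \<omega>|M. s n \<omega> * s m \<omega>) = 0"
    and "\<And>n m. (LINT \<omega>|M. cnj (s n \<omega>) * s m \<omega>) = (if n = m then 1 else 0)"
    (* the Karhunen-Loeve expansion, almost surely in L^2 *)
    and "AE \<omega> in M. \<Phi> \<omega> \<in> l2_space \<Lambda> \<and>
           (\<lambda>N. l2_norm \<Lambda> (\<lambda>x. \<Phi> \<omega> x - (\<Sum>n<N. s n \<omega> * complex_of_real (sqrt (\<mu> n)) * \<phi> n x)))
             \<longlonglongrightarrow> 0"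
    and "l2_nonneg_trace_class \<Lambda> T\<^sub>C"
    and "\<epsilon> > 0"
  shows "((\<lambda>r. cond_prob M
            (\<lambda>\<omega>. l2_norm \<Lambda>
                   (l2_orthogonal_component \<Lambda> (l2_eigenspace \<Lambda> T\<^sub>C \<kappa>\<^sub>1)
                     (\<lambda>x. \<Phi> \<omega> x / complex_of_real (l2_norm \<Lambda> (\<Phi> \<omega>)))) > \<epsilon>)
            (\<lambda>\<omega>. (l2_norm \<Lambda> (\<Phi> \<omega>))\<^sup>2 > r)) \<longlongrightarrow> 0) at_top"
proof -
  note [simp] = T\<^sub>C_def
  interpret prob_space M
    by fact
  note op = assms(10) and system = assms(12)[unfolded T\<^sub>C_def] and circular = assms(18)
  define X where "X n \<omega> = (cmod (s n \<omega>))\<^sup>2" for n \<omega>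
  have s [measurable]: "s n \<in> borel_measurable M" for n
    using assms(16) by (simp add: indep_vars_def)
  have unit: "(LINT \<omega>|M. cnj (s n \<omega>) * s n \<omega>) = 1" for n
    using assms(21)[of n n] by simp
  interpret independent_exponentials M X
  proof unfold_locales
    show "indep_vars (\<lambda>_. borel) X UNIV"
      unfolding X_def by (rule indep_vars_compose2[OF assms(16), where Y = "\<lambda>_ z. (cmod z)\<^sup>2"]) measurable
    show "0 \<le> X n \<omega>" for n \<omega>
      by (simp add: X_def)
    show "(\<integral>\<^sup>+\<omega>. ennreal (exp (\<theta> * X n \<omega>)) \<partial>M) = ennreal (1 / (1 - \<theta>))" if "\<theta> < 1" for n \<theta>
      unfolding X_def using circular unit that by (rule nn_integral_exp_circular_gaussian)
  qed
  define J where "J = {n. \<mu> n = \<kappa>\<^sub>1}"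
  have \<mu>_nonneg: "0 \<le> \<mu> n" and \<mu>_antimono: "m \<le> n \<Longrightarrow> \<mu> n \<le> \<mu> m"
    and eigen: "\<phi> n \<in> l2_eigenspace \<Lambda> (kernel_operator \<Lambda> C) (\<mu> n)"
    and on: "l2_inner \<Lambda> (\<phi> m) (\<phi> n) = (if m = n then 1 else 0)" for m n
    using system by (auto simp: l2_eigen_system_def antimono_def)
  have \<phi>: "\<phi> n \<in> l2_space \<Lambda>" for n
    using eigen[of n] by (simp add: l2_eigenspace_def)
  have \<mu>_le: "\<mu> n \<le> \<kappa>\<^sub>1" for n
  proof (rule assms(14))
    have "l2_norm \<Lambda> (\<phi> n) \<noteq> 0"
      using l2_inner_self[of \<Lambda> "\<phi> n"] on[of n n] by auto
    then show "\<mu> n \<in> l2_eigenvalues \<Lambda> T\<^sub>C"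
      using eigen[of n] l2_norm_eq_0_iff[OF \<phi>] by (auto simp: l2_eigenvalues_def)
  qed
  \<comment> \<open>A nonzero eigenfunction for \<open>\<kappa>\<^sub>1\<close> cannot be
    approximated within its own norm by the empty combination, so \<open>J\<close> is nonempty;
    monotonicity of \<open>\<mu>\<close> then puts index 0 into it.\<close>
  have "0 \<in> J"
  proof -
    from assms(13) obtain f where f: "f \<in> l2_eigenspace \<Lambda> (kernel_operator \<Lambda> C) \<kappa>\<^sub>1"
      and nonzero: "\<not> (AE x in lebesgue_on \<Lambda>. f x = 0)"
      by (auto simp: l2_eigenvalues_def)
    have "f \<in> l2_space \<Lambda>"
      using f by (simp add: l2_eigenspace_def)
    with nonzero have "l2_norm \<Lambda> f > 0"
      using l2_norm_eq_0_iff[of f \<Lambda>] l2_norm_nonneg[of \<Lambda> f] by linarith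
    moreover have "l2_orthonormal_basis \<Lambda> (l2_eigenspace \<Lambda> (kernel_operator \<Lambda> C) \<kappa>\<^sub>1) J \<phi>"
      using system assms(15) by (simp add: l2_eigen_system_def J_def)
    ultimately obtain F c where F: "F \<subseteq> J"
      and "l2_norm \<Lambda> (\<lambda>x. f x - (\<Sum>n\<in>F. c n * \<phi> n x)) < l2_norm \<Lambda> f"
      using f unfolding l2_orthonormal_basis_def by blast
    then have "F \<noteq> {}"
      by auto
    with F obtain n where "n \<in> J"
      by blast
    then show ?thesis
      using \<mu>_le[of 0] \<mu>_antimono[of 0 n] by (simp add: J_def)
  qed
  define a where "a \<omega> n = s n \<omega> * complex_of_real (sqrt (\<mu> n))" for \<omega> n
  have a_sq: "(cmod (a \<omega> n))\<^sup>2 = \<mu> n * X n \<omega>" for \<omega> n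
    using \<mu>_nonneg[of n] by (simp add: a_def X_def norm_mult power_mult_distrib)
  have expansion: "AE \<omega> in M. \<Phi> \<omega> \<in> l2_space \<Lambda> \<and>
      (\<lambda>N. l2_norm \<Lambda> (\<lambda>x. \<Phi> \<omega> x - (\<Sum>n<N. a \<omega> n * \<phi> n x))) \<longlonglongrightarrow> 0"
    using assms(22) by (simp add: a_def)
  have A: "AE \<omega> in M. (\<lambda>n. \<mu> n * X n \<omega>) sums (l2_norm \<Lambda> (\<Phi> \<omega>))\<^sup>2"
    using expansion
  proof eventually_elim
    case (elim \<omega>)
    then show ?case
      using l2_expansion_residual_sums[OF \<phi> on, of "\<Phi> \<omega>" "a \<omega>" "{}"] by (simp add: a_sq)
  qed
  \<comment> \<open>Almost sure finiteness of the squared norm forces the weights to be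
    summable.\<close>
  have summable: "summable \<mu>"
    using \<mu>_nonneg by (rule summable_weights) (use A in \<open>auto elim!: eventually_mono dest: sums_summable\<close>)
  \<comment> \<open>Summable weights tend to zero, so only finitely many can equal the positive
    number \<open>\<kappa>\<^sub>1\<close>.\<close>
  have J: "finite J"
  proof -
    have "eventually (\<lambda>n. \<mu> n < \<kappa>\<^sub>1) sequentially"
      using summable_LIMSEQ_zero[OF summable] assms(15) by (rule order_tendstoD)
    then show ?thesis
      by (auto simp: J_def eventually_cofinite not_less simp flip: cofinite_eq_sequentially
          intro: rev_finite_subset)
  qed
  \<comment> \<open>As \<open>\<mu>\<close> decreases from index 0 in \<open>J\<close>, the set
    \<open>J\<close> is the initial segment below \<open>g\<close>. Thus \<open>g\<close> is the
    multiplicity of \<open>\<kappa>\<^sub>1\<close>, and \<open>\<mu> g\<close>, possibly 0, is the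
    largest weight off \<open>J\<close>.\<close>
  define g where "g = (LEAST n. n \<notin> J)"
  have "\<exists>n. n \<notin> J"
    using J by (metis ex_new_if_finite infinite_UNIV_nat)
  then have g: "g \<notin> J"
    unfolding g_def by (rule LeastI_ex)
  have B: "AE \<omega> in M. (\<lambda>n. if n \<in> J then 0 else \<mu> n * X n \<omega>) sums
      (l2_norm \<Lambda> (\<lambda>x. \<Phi> \<omega> x - (\<Sum>n\<in>J. a \<omega> n * \<phi> n x)))\<^sup>2"
    using expansion
  proof eventually_elim
    case (elim \<omega>)
    then show ?case
      using l2_expansion_residual_sums[OF \<phi> on, of "\<Phi> \<omega>" "a \<omega>" J, unfolded a_sq] J by simp
  qed
  show ?thesis
  proof (rule cond_prob_subleading_tendsto_0[OF \<mu>_nonneg summable \<open>0 \<in> J\<close> _ _ \<mu>_nonneg _ _ _ A B])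
    show "\<mu> n = \<kappa>\<^sub>1" if "n \<in> J" for n
      using that by (simp add: J_def)
    show "\<mu> n \<le> \<mu> g" if "n \<notin> J" for n
      using that unfolding g_def by (intro \<mu>_antimono Least_le)
    show "\<mu> g < \<kappa>\<^sub>1"
      using g \<mu>_le[of g] by (simp add: J_def)
    show "\<epsilon>\<^sup>2 > 0"
      using assms(24) by simp
    show "exp (- (sqrt u + 1)\<^sup>2) / sqrt pi \<le> prob {\<omega> \<in> space M. X 0 \<omega> > u}" if "u \<ge> 0" for u
      unfolding X_def using circular unit s that by (rule circular_gaussian_tail_ge)
    show "AE \<omega> in M. l2_norm \<Lambda> (l2_orthogonal_component \<Lambda> (l2_eigenspace \<Lambda> T\<^sub>C \<kappa>\<^sub>1)
          (\<lambda>x. \<Phi> \<omega> x / complex_of_real (l2_norm \<Lambda> (\<Phi> \<omega>)))) > \<epsilon> \<longrightarrow> (l2_norm \<Lambda> (\<Phi> \<omega>))\<^sup>2 > 0 \<longrightarrow>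
        \<epsilon>\<^sup>2 * (l2_norm \<Lambda> (\<Phi> \<omega>))\<^sup>2 \<le> (l2_norm \<Lambda> (\<lambda>x. \<Phi> \<omega> x - (\<Sum>n\<in>J. a \<omega> n * \<phi> n x)))\<^sup>2"
      using expansion
    proof (eventually_elim, intro impI)
      fix \<omega>
      assume KL: "\<Phi> \<omega> \<in> l2_space \<Lambda> \<and>
          (\<lambda>N. l2_norm \<Lambda> (\<lambda>x. \<Phi> \<omega> x - (\<Sum>n<N. a \<omega> n * \<phi> n x))) \<longlonglongrightarrow> 0"
        and large: "l2_norm \<Lambda> (l2_orthogonal_component \<Lambda> (l2_eigenspace \<Lambda> T\<^sub>C \<kappa>\<^sub>1)
          (\<lambda>x. \<Phi> \<omega> x / complex_of_real (l2_norm \<Lambda> (\<Phi> \<omega>)))) > \<epsilon>"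
        and pos: "(l2_norm \<Lambda> (\<Phi> \<omega>))\<^sup>2 > 0"
      define N R where "N = l2_norm \<Lambda> (\<Phi> \<omega>)" and "R = l2_norm \<Lambda> (\<lambda>x. \<Phi> \<omega> x - (\<Sum>n\<in>J. a \<omega> n * \<phi> n x))"
      have N: "N > 0"
        using pos l2_norm_nonneg[of \<Lambda> "\<Phi> \<omega>"] by (simp add: N_def order_less_le)
      \<comment> \<open>By the component formula with \<open>c\<close> equal to the norm of the
        field, the orthogonal part of the normalised field has norm \<open>R / N\<close>.\<close>
      have "\<epsilon> < R / N"
        using l2_norm_eigenspace_component[OF op system assms(15), of "\<Phi> \<omega>" "a \<omega>" "complex_of_real N"]
          J KL large N by (simp add: J_def R_def N_def)
      then have "\<epsilon> * N \<le> R"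
        using N by (simp add: field_simps)
      then have "(\<epsilon> * N)\<^sup>2 \<le> R\<^sup>2"
        using N assms(24) by (intro power_mono) auto
      then show "\<epsilon>\<^sup>2 * (l2_norm \<Lambda> (\<Phi> \<omega>))\<^sup>2
          \<le> (l2_norm \<Lambda> (\<lambda>x. \<Phi> \<omega> x - (\<Sum>n\<in>J. a \<omega> n * \<phi> n x)))\<^sup>2"
        by (simp add: N_def R_def power_mult_distrib)
    qed
  qed
qed

end
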